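(* Let $n\ge 1$, $1<p<\infty$, $z_0=(z_0^{(1)},\ldots,z_0^{(n)})\in B_n$ and $w_0\in\mathbb{C}$. Among all $f\in A^p_n$ satisfying the single interpolation condition $f(z_0)=w_0$ there is a unique one of minimal $A^p_n$-norm, and it is given by $$f_{\min}(z)=w_0\left(\frac{1-\|z_0\|_{\rm Eucl}^2}{1-\langle z,z_0\rangle_{\rm Eucl}}\right)^{\frac{2(n+1)}{p}}=w_0\left(\frac{1-\sum_{j=1}^n|z_0^{(j)}|^2}{1-\sum_{j=1}^n z_j\overline{z_0^{(j)}}}\right)^{\frac{2(n+1)}{p}},\qquad z=(z_1,\ldots,z_n)\in B_n.$$ In addition, $\|f_{\min}\|_{A^p_n}=|w_0|\,(1-\|z_0\|_{\rm Eucl}^2)^{\frac{n+1}{p}}$.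
   Context: $\langle z,w\rangle_{\rm Eucl}=\sum_{i=1}^n z_i\overline{w_i}$ is the Euclidean inner product on $\mathbb{C}^n$, with norm $\|\cdot\|_{\rm Eucl}$; $B_n=\{z\in\mathbb{C}^n:\|z\|_{\rm Eucl}<1\}$ is the open unit ball. Let $\nu$ be Lebesgue measure on $\mathbb{C}^n$ normalized so that $\nu(B_n)=1$. The Bergman space $A^p_n$ is the space of holomorphic functions $f:B_n\to\mathbb{C}$ with $$\|f\|_{A^p_n}=\left(\int_{B_n}|f|^p\,d\nu\right)^{1/p}<\infty .$$ The fractional power is taken with the principal branch (the base has positive real part on $B_n$). *)

theory Defs
  imports "HOL-Analysis.Analysis"
begin

text \<open>
  The space of $n$-tuples of complex numbers is \<^typ>\<open>complex ^ 'n\<close>, with \<open>n = CARD('n)\<close>. Its library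
  norm is the Euclidean norm of the tuple, so \<open>ball 0 1\<close> is the open unit ball.
  The library inner product on this type is the real one, hence the following definition.
\<close>

definition hinner :: "complex ^ 'n \<Rightarrow> complex ^ 'n \<Rightarrow> complex" where
  "hinner z w = (\<Sum>i\<in>UNIV. z $ i * cnj (w $ i))"

text \<open>
  Holomorphy in several variables, for open sets: the Frechet derivative exists at every point
  and is complex-linear.
\<close>

definition holomorphic_several_on ::
    "(complex ^ 'n \<Rightarrow> complex) \<Rightarrow> (complex ^ 'n) set \<Rightarrow> bool" where
  "holomorphic_several_on f S \<longleftrightarrow>
     (\<forall>z\<in>S. \<exists>D. (f has_derivative D) (at z) \<and> (\<forall>c v. D (c *s v) = c * D v))"

definition nu :: "(complex ^ 'n) measure" where
  "nu = scale_measure (1 / emeasure lebesgue (ball (0 :: complex ^ 'n) 1)) lebesgue"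

lemma emeasure_nu_ball: "emeasure nu (ball (0 :: complex ^ 'n) 1) = 1"
proof -
  have "emeasure lebesgue (ball (0 :: complex ^ 'n) 1) > 0"
    using open_not_negligible[of "ball (0 :: complex ^ 'n) 1"]
    by (auto simp: negligible_iff_emeasure0 zero_less_iff_neq_zero)
  moreover have "emeasure lebesgue (ball (0 :: complex ^ 'n) 1) < \<infinity>"
    using emeasure_bounded_finite[of "ball (0 :: complex ^ 'n) 1"] by simp
  ultimately show ?thesis
    by (simp add: nu_def ennreal_divide_self ennreal_divide_times less_top)
qed

text \<open>
  Functions on the ball are represented by total functions whose values outside the ball are
  irrelevant; two of them are the same element of the Bergman space iff they agree on the ball.
\<close>

definition bergman_space :: "real \<Rightarrow> (complex ^ 'n \<Rightarrow> complex) set" where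
  "bergman_space p = {f. holomorphic_several_on f (ball 0 1) \<and>
                         set_integrable nu (ball 0 1) (\<lambda>z. norm (f z) powr p)}"

definition bergman_norm :: "real \<Rightarrow> (complex ^ 'n \<Rightarrow> complex) \<Rightarrow> real" where
  "bergman_norm p f = (LINT z:ball 0 1|nu. norm (f z) powr p) powr (1 / p)"

end

theory Submission
  imports Defs "HOL-Complex_Analysis.Cauchy_Integral_Formula"
begin

text \<open>
  Let \<open>K\<close> be the Jacobian of the inverse of the ball automorphism that takes 0 to \<open>z0\<close>. A change of
  variables and the mean value property (averaging over the circles \<open>e\<^sup>i\<^sup>\<theta> z\<close>) give \<open>\<integral> K g d\<nu> = g z0\<close> for
  holomorphic \<open>g\<close>. If \<open>\<alpha>\<close> denotes the extremal function for \<open>w0 = 1\<close>, then \<open>\<bar>\<alpha>\<bar>\<^sup>p\<close> is a constant times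
  \<open>K\<close>, so writing \<open>f = g \<alpha>\<close> reduces the problem to minimising \<open>\<integral> K \<bar>g\<bar>\<^sup>p d\<nu>\<close> subject to \<open>g z0 = w0\<close>.
  The tangent of the strictly convex function \<open>\<bar>g\<bar>\<^sup>p\<close> at \<open>w0\<close> is real affine in \<open>g\<close>, so its integral
  depends only on \<open>g z0\<close>, and equality forces \<open>g = w0\<close>.
\<close>

section \<open>Invariance of Lebesgue measure\<close>

text \<open>The obstacle is the change of variables: \<open>ball_aut\<close> is nonlinear, and its
  real Jacobian determinant is unpleasant to compute. It is therefore lifted to the linear map
  \<open>boost\<close> on pairs (t, w), where w / t is the point of the ball. There only
  preservation of measure is needed, and a factorisation into shears gives that. The exponent 2n + 2
  in \<open>K\<close> is then 2n, from rescaling the fibre t * ball, plus 2, from rescaling the disc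
  of t. The exponent 2(n + 1) / p makes the constant in front of \<open>K\<close> equal to (1 -
  |z0|^2)^(n+1). Since \<open>K\<close> has integral 1 against \<nu>, this constant is the p-th
  power of the minimal norm for w0 = 1. Dividing by \<alpha> keeps functions holomorphic because the
  base of the power has positive real part on the ball.\<close>

lemma nn_integral_lborel_translate:
  fixes f :: "'a::euclidean_space \<Rightarrow> ennreal"
  assumes [measurable]: "f \<in> borel_measurable borel"
  shows "(\<integral>\<^sup>+x. f (x + c) \<partial>lborel) = (\<integral>\<^sup>+x. f x \<partial>lborel)"
proof -
  have "(\<integral>\<^sup>+x. f x \<partial>lborel) = (\<integral>\<^sup>+x. f x \<partial>distr lborel borel ((+) c))"
    by (simp add: lborel_distr_plus)
  also have "\<dots> = (\<integral>\<^sup>+x. f (c + x) \<partial>lborel)"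
    by (subst nn_integral_distr) auto
  finally show ?thesis by (simp add: add.commute)
qed

text \<open>Fubini: for a fixed first coordinate the map is a translation of the second. Shears take
  the place of determinants in the change of variables.\<close>

lemma nn_integral_lborel_shear_snd:
  fixes f :: "'a::euclidean_space \<times> 'b::euclidean_space \<Rightarrow> ennreal"
  assumes f [measurable]: "f \<in> borel_measurable borel" and [measurable]: "h \<in> borel_measurable borel"
  shows "(\<integral>\<^sup>+x. f (fst x, snd x + h (fst x)) \<partial>lborel) = (\<integral>\<^sup>+x. f x \<partial>lborel)"
proof -
  have [measurable]: "f \<in> borel_measurable (borel \<Otimes>\<^sub>M borel)"
    using f by (simp add: borel_prod)
  have "(\<integral>\<^sup>+x. f (fst x, snd x + h (fst x)) \<partial>(lborel \<Otimes>\<^sub>M lborel))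
      = (\<integral>\<^sup>+x. (\<integral>\<^sup>+y. f (x, y + h x) \<partial>lborel) \<partial>lborel)"
    by (subst lborel.nn_integral_fst [symmetric]) auto
  also have "\<dots> = (\<integral>\<^sup>+x. (\<integral>\<^sup>+y. f (x, y) \<partial>lborel) \<partial>lborel)"
    by (subst nn_integral_lborel_translate) auto
  also have "\<dots> = (\<integral>\<^sup>+x. f x \<partial>(lborel \<Otimes>\<^sub>M lborel))"
    by (subst lborel.nn_integral_fst) auto
  finally show ?thesis by (simp add: lborel_prod)
qed

lemma nn_integral_lborel_shear_fst:
  fixes f :: "'a::euclidean_space \<times> 'b::euclidean_space \<Rightarrow> ennreal"
  assumes f [measurable]: "f \<in> borel_measurable borel" and [measurable]: "h \<in> borel_measurable borel"
  shows "(\<integral>\<^sup>+x. f (fst x + h (snd x), snd x) \<partial>lborel) = (\<integral>\<^sup>+x. f x \<partial>lborel)"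
proof -
  have [measurable]: "f \<in> borel_measurable (borel \<Otimes>\<^sub>M borel)"
    using f by (simp add: borel_prod)
  have "(\<integral>\<^sup>+x. f (fst x + h (snd x), snd x) \<partial>(lborel \<Otimes>\<^sub>M lborel))
      = (\<integral>\<^sup>+y. (\<integral>\<^sup>+x. f (x + h y, y) \<partial>lborel) \<partial>lborel)"
    by (subst lborel_pair.nn_integral_snd [symmetric]) auto
  also have "\<dots> = (\<integral>\<^sup>+y. (\<integral>\<^sup>+x. f (x, y) \<partial>lborel) \<partial>lborel)"
    by (subst nn_integral_lborel_translate [where f = "\<lambda>x. f (x, _)"]) auto
  also have "\<dots> = (\<integral>\<^sup>+x. f x \<partial>(lborel \<Otimes>\<^sub>M lborel))"
    by (subst lborel_pair.nn_integral_snd) auto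
  finally show ?thesis by (simp add: lborel_prod)
qed

text \<open>Separates real from imaginary parts, so that multiplication by a unit scalar becomes a
  plane rotation of a pair of real vectors, to which the shear lemmas apply.\<close>

definition vec_Complex :: "(real ^ 'n) \<times> (real ^ 'n) \<Rightarrow> complex ^ 'n" where
  "vec_Complex w = (\<chi> i. Complex (fst w $ i) (snd w $ i))"

lemma continuous_on_vec_Complex: "continuous_on S vec_Complex"
  unfolding vec_Complex_def Complex_eq by (intro continuous_intros)

lemma vec_Complex_measurable [measurable]: "vec_Complex \<in> borel_measurable borel"
  by (intro borel_measurable_continuous_onI continuous_on_vec_Complex)

lemma distr_vec_Complex: "distr lborel borel vec_Complex = (lborel :: (complex ^ 'n) measure)"
proof (rule lborel_eqI [symmetric])
  fix l u :: "complex ^ 'n"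
  assume lu: "\<And>b. b \<in> Basis \<Longrightarrow> l \<bullet> b \<le> u \<bullet> b"
  define R where "R = (\<lambda>z :: complex ^ 'n. \<chi> i. Re (z $ i))"
  define I where "I = (\<lambda>z :: complex ^ 'n. \<chi> i. Im (z $ i))"
  have R: "R l \<bullet> b \<le> R u \<bullet> b" and I: "I l \<bullet> b \<le> I u \<bullet> b" if Basis: "b \<in> Basis" for b
  proof -
    obtain i where b: "b = axis i 1" using Basis by (auto simp: Basis_vec_def)
    show "R l \<bullet> b \<le> R u \<bullet> b" "I l \<bullet> b \<le> I u \<bullet> b"
      using lu [of "axis i 1"] lu [of "axis i \<i>"]
      by (auto simp: b R_def I_def inner_axis Basis_vec_def Basis_complex_def)
  qed
  \<comment> \<open>Each basis vector is \<open>axis i 1\<close> or \<open>axis i \<i>\<close>, so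
    the bounds on real and imaginary parts separate.\<close>
  have "vec_Complex -` box l u = box (R l) (R u) \<times> box (I l) (I u)"
    by (auto simp: vec_Complex_def R_def I_def mem_box Basis_vec_def Basis_complex_def inner_axis
        inner_complex_def)
  then have "emeasure (distr lborel borel vec_Complex) (box l u)
      = emeasure (lborel \<Otimes>\<^sub>M lborel) (box (R l) (R u) \<times> box (I l) (I u))"
    by (subst emeasure_distr) (auto simp: lborel_prod)
  also have "\<dots> = emeasure lborel (box (R l) (R u)) * emeasure lborel (box (I l) (I u))"
    by (rule lborel.emeasure_pair_measure_Times) auto
  also have "\<dots> = ennreal ((\<Prod>b\<in>Basis. (R u - R l) \<bullet> b) * (\<Prod>b\<in>Basis. (I u - I l) \<bullet> b))"
    using R I by (simp add: emeasure_lborel_box ennreal_mult prod_nonneg inner_diff_left)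
  also have "(\<Prod>b\<in>Basis. (R u - R l) \<bullet> b) * (\<Prod>b\<in>Basis. (I u - I l) \<bullet> b) = (\<Prod>b\<in>Basis. (u - l) \<bullet> b)"
  proof -
    have *: "(\<Prod>b\<in>Basis. x \<bullet> b) = (\<Prod>i\<in>UNIV. x $ i)" for x :: "real ^ 'n"
    proof -
      have "(Basis :: (real ^ 'n) set) = (\<lambda>i. axis i 1) ` UNIV"
        by (auto simp: Basis_vec_def)
      then have "(\<Prod>b\<in>Basis. x \<bullet> b) = (\<Prod>b\<in>(\<lambda>i. axis i 1) ` UNIV. x \<bullet> b)"
        by (rule arg_cong)
      also have "\<dots> = (\<Prod>i\<in>UNIV. x $ i)"
        by (subst prod.reindex) (auto simp: inj_on_def axis_eq_axis inner_axis)
      finally show ?thesis .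
    qed
    have "(Basis :: (complex ^ 'n) set) = (\<lambda>i. axis i 1) ` UNIV \<union> (\<lambda>i. axis i \<i>) ` UNIV"
      by (auto simp: Basis_vec_def Basis_complex_def)
    then have "(\<Prod>b\<in>Basis. (u - l) \<bullet> b)
        = (\<Prod>b\<in>(\<lambda>i. axis i 1) ` UNIV \<union> (\<lambda>i. axis i \<i>) ` UNIV. (u - l) \<bullet> b)"
      by (rule arg_cong)
    also have "\<dots> = (\<Prod>i\<in>UNIV. Re ((u - l) $ i)) * (\<Prod>i\<in>UNIV. Im ((u - l) $ i))"
      by (subst prod.union_disjoint)
         (auto simp: disjoint_iff prod.reindex inj_on_def axis_eq_axis inner_axis)
    finally show ?thesis
      by (simp add: * R_def I_def)
  qed
  finally show "emeasure (distr lborel borel vec_Complex) (box l u) = (\<Prod>b\<in>Basis. (u - l) \<bullet> b)" .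
qed simp

lemma nn_integral_vec_Complex:
  assumes [measurable]: "f \<in> borel_measurable borel"
  shows "(\<integral>\<^sup>+z. f (vec_Complex z) \<partial>lborel) = (\<integral>\<^sup>+z. f z \<partial>lborel)"
  using nn_integral_distr [of vec_Complex lborel borel f] by (simp add: distr_vec_Complex)

lemma continuous_on_vector_smult [continuous_intros]:
  fixes g :: "'a::topological_space \<Rightarrow> complex ^ 'n"
  assumes "continuous_on S f" "continuous_on S g"
  shows "continuous_on S (\<lambda>x. f x *s g x)"
  unfolding vector_scalar_mult_def using assms by (intro continuous_intros)

lemma vector_smult_measurable [measurable]:
  fixes g :: "'a \<Rightarrow> complex ^ 'n"
  assumes [measurable]: "f \<in> borel_measurable M" "g \<in> borel_measurable M"
  shows "(\<lambda>x. f x *s g x) \<in> borel_measurable M"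
proof -
  have "(\<lambda>y. fst y *s snd y) \<in> borel_measurable (borel :: (complex \<times> (complex ^ 'n)) measure)"
    by (intro borel_measurable_continuous_onI continuous_intros)
  then show ?thesis
    using measurable_compose [OF borel_measurable_Pair [OF assms], of "\<lambda>y. fst y *s snd y"] by simp
qed

lemma nn_integral_unit_smult:
  fixes f :: "complex ^ 'n \<Rightarrow> ennreal"
  assumes f [measurable]: "f \<in> borel_measurable borel" and "norm c = 1"
  shows "(\<integral>\<^sup>+z. f (c *s z) \<partial>lborel) = (\<integral>\<^sup>+z. f z \<partial>lborel)"
proof -
  text \<open>A rotation of the plane by an angle that is not a multiple of pi is a product of three shears.\<close>
  have nonreal: "(\<integral>\<^sup>+z. g (d *s z) \<partial>lborel) = (\<integral>\<^sup>+z. g z \<partial>lborel)"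
    if g [measurable]: "g \<in> borel_measurable borel" and d: "norm d = 1" "Im d \<noteq> 0"
    for g :: "complex ^ 'n \<Rightarrow> ennreal" and d
  proof -
    \<comment> \<open>For d = exp (i x) this is - tan (x / 2), while \<open>Im d\<close> is sin x:
      the classical factorisation of a rotation.\<close>
    define m where "m = (Re d - 1) / Im d"
    have d2: "(Re d)\<^sup>2 + (Im d)\<^sup>2 = 1"
      using d by (simp add: cmod_def)
    define G where "G = g \<circ> vec_Complex"
    define A where "A = (\<lambda>w :: (real ^ 'n) \<times> (real ^ 'n). (fst w + m *\<^sub>R snd w, snd w))"
    define B where "B = (\<lambda>w :: (real ^ 'n) \<times> (real ^ 'n). (fst w, snd w + Im d *\<^sub>R fst w))"
    have [measurable]: "A \<in> borel_measurable borel" "B \<in> borel_measurable borel"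
      unfolding A_def B_def by (intro borel_measurable_continuous_onI continuous_intros)+
    have [measurable]: "G \<in> borel_measurable borel"
      unfolding G_def by measurable
    have A: "(\<integral>\<^sup>+w. h (A w) \<partial>lborel) = (\<integral>\<^sup>+w. h w \<partial>lborel)"
      if "h \<in> borel_measurable borel" for h
      unfolding A_def by (rule nn_integral_lborel_shear_fst [OF that]) auto
    have B: "(\<integral>\<^sup>+w. h (B w) \<partial>lborel) = (\<integral>\<^sup>+w. h w \<partial>lborel)"
      if "h \<in> borel_measurable borel" for h
      unfolding B_def by (rule nn_integral_lborel_shear_snd [OF that]) auto
    have "Re d = 1 + m * Im d" "- Im d = m * (1 + Re d)"
      using d2 d(2) by (simp_all add: m_def field_simps power2_eq_square)
    then have "d *s vec_Complex w = vec_Complex (A (B (A w)))" for w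
      unfolding A_def B_def vec_Complex_def vec_eq_iff complex_eq_iff
      by (auto simp: algebra_simps) algebra+
    then have "(\<integral>\<^sup>+z. g (d *s z) \<partial>lborel) = (\<integral>\<^sup>+w. G (A (B (A w))) \<partial>lborel)"
      by (subst nn_integral_vec_Complex [symmetric]) (auto simp: G_def)
    also have "\<dots> = (\<integral>\<^sup>+w. G w \<partial>lborel)"
      by (subst A [of "\<lambda>w. G (A (B w))"], simp, subst B [of "\<lambda>w. G (A w)"], simp, subst A) auto
    finally show ?thesis
      by (simp add: G_def nn_integral_vec_Complex)
  qed
  show ?thesis
  proof (cases "Im c = 0")
    case False
    then show ?thesis by (rule nonreal [OF f assms(2)])
  next
    case True
    then have "c = 1 \<or> c = - 1"
      using assms(2) by (auto simp: cmod_def complex_eq_iff power2_eq_1_iff)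
    then show ?thesis
    proof
      \<comment> \<open>The half turn escapes the shear factorisation, which divides by
        \<open>Im d\<close>, but it is two quarter turns.\<close>
      assume "c = - 1"
      then have c: "c *s z = \<i> *s (\<i> *s z)" for z :: "complex ^ 'n"
        by (simp add: vector_smult_assoc)
      have "(\<integral>\<^sup>+z. f (c *s z) \<partial>lborel) = (\<integral>\<^sup>+z. f (\<i> *s z) \<partial>lborel)"
        unfolding c by (rule nonreal) auto
      also have "\<dots> = (\<integral>\<^sup>+z. f z \<partial>lborel)"
        by (rule nonreal) auto
      finally show ?thesis .
    qed simp
  qed
qed

text \<open>Polar decomposition of c: the rotation by \<open>sgn c\<close> preserves the measure,
  and the dilation by \<open>norm c\<close> acts in real dimension 2n.\<close>

lemma nn_integral_smult:
  fixes f :: "complex ^ 'n \<Rightarrow> ennreal"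
  assumes [measurable]: "f \<in> borel_measurable borel" and "c \<noteq> 0"
  shows "(\<integral>\<^sup>+z. f z \<partial>lborel) = ennreal (norm c ^ (2 * CARD('n))) * (\<integral>\<^sup>+z. f (c *s z) \<partial>lborel)"
proof -
  have "(\<integral>\<^sup>+z. f z \<partial>lborel) = ennreal (norm c ^ (CARD('n) * 2)) * (\<integral>\<^sup>+z. f (norm c *\<^sub>R z) \<partial>lborel)"
    using assms(2)
    by (subst lborel_affine [of "norm c" 0], simp)
       (simp add: nn_integral_density nn_integral_distr nn_integral_cmult)
  also have "(\<integral>\<^sup>+z. f (norm c *\<^sub>R z) \<partial>lborel) = (\<integral>\<^sup>+z. f (norm c *\<^sub>R (sgn c *s z)) \<partial>lborel)"
    using assms(2)
    by (intro nn_integral_unit_smult [of "\<lambda>z. f (norm c *\<^sub>R z)", symmetric]) (auto simp: norm_sgn)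
  also have "\<dots> = (\<integral>\<^sup>+z. f (c *s z) \<partial>lborel)"
  proof -
    have "(\<lambda>z :: complex ^ 'n. norm c *\<^sub>R (sgn c *s z)) = (\<lambda>z. c *s z)"
      using assms(2) unfolding fun_eq_iff vec_eq_iff vector_scaleR_component vector_smult_component
      by (simp add: sgn_eq scaleR_conv_of_real)
    then show ?thesis by (simp add: fun_eq_iff)
  qed
  finally show ?thesis by (simp add: mult.commute)
qed

section \<open>Hermitian product and Euclidean norm\<close>

lemma ball_borel [measurable]: "ball x r \<in> sets borel"
  by simp

lemma hinner_add_left: "hinner (z + w) a = hinner z a + hinner w a"
  by (simp add: hinner_def algebra_simps sum.distrib)

lemma hinner_smult_left: "hinner (c *s z) a = c * hinner z a"
  by (simp add: hinner_def algebra_simps sum_distrib_left)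

lemma hinner_zero_left [simp]: "hinner 0 a = 0"
  by (simp add: hinner_def)

lemma norm_vec_power2: "(norm (z :: complex ^ 'n))\<^sup>2 = (\<Sum>i\<in>UNIV. (norm (z $ i))\<^sup>2)"
  by (simp add: norm_vec_def L2_set_def sum_nonneg)

lemma hinner_self: "hinner z z = complex_of_real ((norm z)\<^sup>2)"
  by (simp add: hinner_def norm_vec_power2 complex_norm_square [symmetric])

lemma norm_hinner_le: "norm (hinner z a) \<le> norm z * norm a"
proof -
  have "norm (hinner z a) \<le> (\<Sum>i\<in>UNIV. \<bar>norm (z $ i)\<bar> * \<bar>norm (a $ i)\<bar>)"
    unfolding hinner_def by (rule norm_sum [THEN order_trans]) (simp add: norm_mult)
  also have "\<dots> \<le> norm z * norm a"
    unfolding norm_vec_def by (rule L2_set_mult_ineq)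
  finally show ?thesis .
qed

lemma norm_add_smult_power2:
  "(norm (z + c *s a))\<^sup>2 = (norm z)\<^sup>2 + 2 * Re (c * cnj (hinner z a)) + (norm c)\<^sup>2 * (norm a)\<^sup>2"
proof -
  have "(norm (z $ i + c * a $ i))\<^sup>2 = (norm (z $ i))\<^sup>2 + 2 * Re (c * (cnj (z $ i) * a $ i)) + (norm c)\<^sup>2 * (norm (a $ i))\<^sup>2" for i
    unfolding cmod_power2 by (simp add: power2_eq_square algebra_simps)
  moreover have "Re (c * cnj (hinner z a)) = (\<Sum>i\<in>UNIV. Re (c * (cnj (z $ i) * a $ i)))"
    unfolding hinner_def by (simp add: sum_distrib_left Re_sum)
  ultimately show ?thesis
    by (simp add: norm_vec_power2 sum.distrib sum_distrib_left)
qed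

lemma norm_smult [simp]: "norm (c *s z) = norm c * norm (z :: complex ^ 'n)"
proof -
  have "(norm (c *s z))\<^sup>2 = (norm c * norm z)\<^sup>2"
    using norm_add_smult_power2 [of 0 c z] by (simp add: power_mult_distrib)
  then show ?thesis
    by (simp add: power2_eq_iff_nonneg)
qed

lemma hinner_measurable [measurable]:
  assumes [measurable]: "f \<in> borel_measurable M"
  shows "(\<lambda>x. hinner (f x) a) \<in> borel_measurable M"
proof -
  have "(\<lambda>z. hinner z a) \<in> borel_measurable borel"
    unfolding hinner_def by (intro borel_measurable_continuous_onI continuous_intros)
  then show ?thesis
    using assms by (auto intro: measurable_compose)
qed

section \<open>Automorphisms of the ball\<close>

text \<open>In the coordinates (t, w / t) the cone becomes a product: its fibre over t is t times
  the ball, and undoing this dilation costs the factor |t|^(2n).\<close>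

lemma nn_integral_cone:
  fixes H :: "complex \<times> (complex ^ 'n) \<Rightarrow> ennreal"
  assumes H: "H \<in> borel_measurable borel"
  shows "(\<integral>\<^sup>+x. indicator {x. norm (snd x) < norm (fst x)} x * H (fst x, inverse (fst x) *s snd x) \<partial>lborel)
       = (\<integral>\<^sup>+t. ennreal (norm t ^ (2 * CARD('n))) * (\<integral>\<^sup>+z. indicator (ball 0 1) z * H (t, z) \<partial>lborel) \<partial>lborel)"
proof -
  have [measurable]: "H \<in> borel_measurable (borel \<Otimes>\<^sub>M borel)"
    using H by (simp add: borel_prod)
  have [measurable]: "Measurable.pred (borel \<Otimes>\<^sub>M borel) (\<lambda>x :: complex \<times> (complex ^ 'n). norm (snd x) < norm (fst x))"
    by measurable
  have "(\<integral>\<^sup>+x. indicator {x. norm (snd x) < norm (fst x)} x * H (fst x, inverse (fst x) *s snd x) \<partial>lborel)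
      = (\<integral>\<^sup>+t. (\<integral>\<^sup>+z. indicator {x. norm (snd x) < norm (fst x)} (t, z) * H (t, inverse t *s z) \<partial>lborel) \<partial>lborel)"
    unfolding lborel_prod [symmetric]
    by (subst lborel.nn_integral_fst [symmetric]) (auto simp: indicator_def cong: if_cong)
  also have "\<dots> = (\<integral>\<^sup>+t. ennreal (norm t ^ (2 * CARD('n))) * (\<integral>\<^sup>+z. indicator (ball 0 1) z * H (t, z) \<partial>lborel) \<partial>lborel)"
  proof (rule nn_integral_cong)
    fix t :: complex
    show "(\<integral>\<^sup>+z. indicator {x. norm (snd x) < norm (fst x)} (t, z) * H (t, inverse t *s z) \<partial>lborel)
      = ennreal (norm t ^ (2 * CARD('n))) * (\<integral>\<^sup>+z. indicator (ball 0 1) z * H (t, z) \<partial>lborel)"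
    \<comment> \<open>The fibre over t = 0 is empty, and the right side vanishes there because the
      exponent is positive.\<close>
    proof (cases "t = 0")
      case False
      have "norm (t *s z) < norm t \<longleftrightarrow> norm z < 1" for z :: "complex ^ 'n"
        using False by simp
      then show ?thesis
        using False
        by (subst nn_integral_smult [where c = t])
           (auto simp: indicator_def vector_smult_assoc cong: if_cong)
    qed (auto simp: indicator_def)
  qed
  finally show ?thesis .
qed

text \<open>Rescaling the disc of radius 1 / c to the unit disc: k powers of 1 / c come from the
  integrand and two from the plane. With k = 2n this produces the exponent 2n + 2 of the
  Jacobian.\<close>

lemma nn_integral_norm_power_disc:
  fixes c :: real
  assumes "c > 0"
  shows "(\<integral>\<^sup>+t. ennreal (norm t ^ k) * indicator {t. norm t * c < 1} t \<partial>(lborel :: complex measure))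
    = ennreal (inverse c ^ (k + 2)) * (\<integral>\<^sup>+t. ennreal (norm t ^ k) * indicator (ball 0 1) t \<partial>(lborel :: complex measure))"
proof -
  have "(\<integral>\<^sup>+t. ennreal (norm t ^ k) * indicator {t. norm t * c < 1} t \<partial>(lborel :: complex measure))
    = ennreal (inverse c ^ 2) * (\<integral>\<^sup>+t. ennreal (norm (inverse c *\<^sub>R t) ^ k) * indicator {t. norm t * c < 1} (inverse c *\<^sub>R t) \<partial>(lborel :: complex measure))"
    using assms
    by (subst lborel_affine [of "inverse c" 0], simp)
       (simp add: nn_integral_density nn_integral_distr nn_integral_cmult)
  also have "\<dots> = ennreal (inverse c ^ 2) * (\<integral>\<^sup>+t. ennreal (inverse c ^ k) * (ennreal (norm t ^ k) * indicator (ball 0 1) t) \<partial>(lborel :: complex measure))"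
  proof (rule arg_cong [where f = "\<lambda>x. _ * x"], rule nn_integral_cong)
    fix t :: complex
    have "norm (inverse c *\<^sub>R t) * c < 1 \<longleftrightarrow> norm t < 1" "norm (inverse c *\<^sub>R t) = inverse c * norm t"
      using assms by (simp_all add: field_simps)
    then show "ennreal (norm (inverse c *\<^sub>R t) ^ k) * indicator {t. norm t * c < 1} (inverse c *\<^sub>R t)
        = ennreal (inverse c ^ k) * (ennreal (norm t ^ k) * indicator (ball 0 1) t)"
      using assms by (simp add: indicator_def power_mult_distrib ennreal_mult)
  qed
  also have "\<dots> = ennreal (inverse c ^ (k + 2)) * (\<integral>\<^sup>+t. ennreal (norm t ^ k) * indicator (ball 0 1) t \<partial>(lborel :: complex measure))"
    using assms by (subst nn_integral_cmult) (auto simp: power_add ennreal_mult power2_eq_square mult_ac)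
  finally show ?thesis .
qed

text \<open>Lets this integral, a common factor of the two evaluations in
  \<open>nn_integral_ball_aut\<close>, be cancelled in \<open>ennreal\<close>; its value is never
  computed.\<close>

lemma nn_integral_norm_power_disc_pos_finite:
  "(\<integral>\<^sup>+t. ennreal (norm t ^ k) * indicator (ball 0 1) t \<partial>(lborel :: complex measure)) \<noteq> 0"
  "(\<integral>\<^sup>+t. ennreal (norm t ^ k) * indicator (ball 0 1) t \<partial>(lborel :: complex measure)) \<noteq> \<infinity>"
proof -
  let ?J = "\<integral>\<^sup>+t. ennreal (norm t ^ k) * indicator (ball 0 1) t \<partial>(lborel :: complex measure)"
  have "?J \<le> (\<integral>\<^sup>+t. indicator (ball 0 1) t \<partial>(lborel :: complex measure))"
    by (intro nn_integral_mono) (auto simp: indicator_def power_le_one)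
  also have "\<dots> < \<infinity>"
    using emeasure_bounded_finite [of "ball (0 :: complex) 1"] by simp
  finally show "?J \<noteq> \<infinity>" by simp
  show "?J \<noteq> 0"
  proof
    assume "?J = 0"
    then have "AE t in (lborel :: complex measure). ennreal (norm t ^ k) * indicator (ball 0 1) t = 0"
      by (subst (asm) nn_integral_0_iff_AE) auto
    moreover have "AE t in (lborel :: complex measure). t \<noteq> 0"
      by (rule AE_lborel_singleton)
    ultimately have "AE t in (lborel :: complex measure). t \<notin> ball 0 1"
      by eventually_elim (auto simp: indicator_def)
    then have "emeasure lborel (ball (0 :: complex) 1) = 0"
      by (subst (asm) AE_iff_measurable [where N = "ball 0 1"]) auto
    then show False
      using open_not_negligible [of "ball (0 :: complex) 1"]
      by (auto simp: negligible_iff_emeasure0 emeasure_completion)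
  qed
qed

text \<open>The reciprocal of the Lorentz factor of velocity \<open>a\<close>. With s =
  \<open>defect a\<close>, the usual boost coefficient (1 / s - 1) / |a|^2 equals 1 / (s (1 + s)), a
  form that also makes sense at a = 0.\<close>

definition defect :: "complex ^ 'n \<Rightarrow> real" where
  "defect a = sqrt (1 - (norm a)\<^sup>2)"

text \<open>
  \<open>boost a\<close> is a linear map of signature (1,n) preserving \<open>\<bar>t\<bar>\<^sup>2 - \<bar>z\<bar>\<^sup>2\<close>; the induced projective map \<open>ball_aut a\<close>
  is the automorphism of the ball that takes 0 to \<open>a\<close>.
\<close>

definition boost :: "complex ^ 'n \<Rightarrow> complex \<times> (complex ^ 'n) \<Rightarrow> complex \<times> (complex ^ 'n)" where
  "boost a x = ((fst x + hinner (snd x) a) / of_real (defect a),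
     snd x + ((fst x + hinner (snd x) a / of_real (1 + defect a)) / of_real (defect a)) *s a)"

definition ball_aut :: "complex ^ 'n \<Rightarrow> complex ^ 'n \<Rightarrow> complex ^ 'n" where
  "ball_aut a z = inverse (fst (boost a (1, z))) *s snd (boost a (1, z))"

lemma ball_aut_measurable [measurable]: "ball_aut a \<in> borel_measurable borel"
  unfolding ball_aut_def boost_def fst_conv snd_conv by measurable

context
  fixes a :: "complex ^ 'n"
  assumes a: "norm a < 1"
begin

lemma defect_pos: "0 < defect a"
  using a by (simp add: defect_def power_less_one_iff abs_square_less_1)

lemma defect_power2: "(defect a)\<^sup>2 = 1 - (norm a)\<^sup>2"
  using a by (simp add: defect_def abs_square_le_1)

lemma norm_hinner_less_1:
  assumes "norm z < 1" shows "norm (hinner z a) < 1"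
  using norm_hinner_le [of z a] mult_strict_mono' [OF assms a] by simp

lemma nn_integral_boost:
  fixes f :: "complex \<times> (complex ^ 'n) \<Rightarrow> ennreal"
  assumes [measurable]: "f \<in> borel_measurable borel"
  shows "(\<integral>\<^sup>+x. f (boost a x) \<partial>lborel) = (\<integral>\<^sup>+x. f x \<partial>lborel)"
proof -
  define s where "s = defect a"
  have s: "s > 0" using defect_pos by (simp add: s_def)
  text \<open>The boost is a product of three shears, so no determinant is needed.\<close>
  define A where "A = (\<lambda>x :: complex \<times> (complex ^ 'n). (fst x + hinner (snd x) a / of_real (1 + s), snd x))"
  define B where "B = (\<lambda>x :: complex \<times> (complex ^ 'n). (fst x, snd x + (fst x / of_real s) *s a))"
  have [measurable]: "A \<in> borel_measurable borel" "B \<in> borel_measurable borel"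
    unfolding A_def B_def hinner_def
    by (intro borel_measurable_continuous_onI continuous_intros; use s in \<open>auto simp: complex_eq_iff\<close>)+
  have A: "(\<integral>\<^sup>+w. h (A w) \<partial>lborel) = (\<integral>\<^sup>+w. h w \<partial>lborel)"
    if "h \<in> borel_measurable borel" for h
    unfolding A_def by (rule nn_integral_lborel_shear_fst [OF that]) auto
  have B: "(\<integral>\<^sup>+w. h (B w) \<partial>lborel) = (\<integral>\<^sup>+w. h w \<partial>lborel)"
    if "h \<in> borel_measurable borel" for h
    unfolding B_def by (rule nn_integral_lborel_shear_snd [OF that]) auto
  \<comment> \<open>If norm a = tanh r, then s = 1 / cosh r, and in the direction of a the shears
    have slopes tanh (r / 2) and sinh r: the hyperbolic form of the rotation factorisation.\<close>
  have ABA: "boost a x = A (B (A x))" for x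
  proof -
    define S where "S = complex_of_real s"
    have S: "1 + S \<noteq> 0" "S \<noteq> 0"
      using s by (auto simp: complex_eq_iff S_def)
    \<comment> \<open>Factored so that the denominators 1 + S cancel.\<close>
    have haa: "hinner a a = (1 - S) * (1 + S)"
      using arg_cong [OF defect_power2, of complex_of_real]
      by (simp add: S_def s_def hinner_self algebra_simps power2_eq_square)
    define h where "h = hinner (snd x) a"
    define t where "t = fst x"
    have "A (B (A x)) = (t + h / (1 + S) + (h + (t + h / (1 + S)) / S * ((1 - S) * (1 + S))) / (1 + S),
        snd x + ((t + h / (1 + S)) / S) *s a)"
      unfolding A_def B_def of_real_add of_real_1 S_def [symmetric]
      by (simp add: hinner_add_left hinner_smult_left haa h_def t_def)
    also have "t + h / (1 + S) + (h + (t + h / (1 + S)) / S * ((1 - S) * (1 + S))) / (1 + S) = (t + h) / S"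
      using S by (simp add: divide_simps) algebra
    finally show ?thesis
      by (simp add: boost_def s_def S_def h_def t_def)
  qed
  have "(\<integral>\<^sup>+x. f (A (B (A x))) \<partial>lborel) = (\<integral>\<^sup>+x. f x \<partial>lborel)"
    by (subst A [of "\<lambda>w. f (A (B w))"], simp, subst B [of "\<lambda>w. f (A w)"], simp, subst A) auto
  then show ?thesis by (simp add: ABA)
qed

lemma boost_form: "(norm (fst (boost a x)))\<^sup>2 - (norm (snd (boost a x)))\<^sup>2 = (norm (fst x))\<^sup>2 - (norm (snd x))\<^sup>2"
proof -
  define s where "s = defect a"
  have s: "s > 0" and s2: "(norm a)\<^sup>2 = 1 - s\<^sup>2"
    using defect_pos defect_power2 unfolding s_def by auto
  define h where "h = hinner (snd x) a"
  define t where "t = fst x"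
  define r where "r = 1 / (1 + s)"
  \<comment> \<open>This relation eliminates the fraction 1 / (1 + s), so that what remains is
    polynomial algebra.\<close>
  have r: "s * r = 1 - r" using s by (simp add: r_def field_simps)
  define k where "k = t + r *\<^sub>R h"
  have k: "(t + h / of_real (1 + s)) / of_real s = k / of_real s"
    by (simp add: k_def r_def scaleR_conv_of_real)
  have "Re (k / of_real s * cnj h) = Re (k * cnj h) / s"
    by (simp add: Re_divide_of_real)
  have "(norm (fst (boost a x)))\<^sup>2 - (norm (snd (boost a x)))\<^sup>2
     = (norm (t + h))\<^sup>2 / s\<^sup>2 - ((norm (snd x))\<^sup>2 + 2 * (Re (k * cnj h) / s) + (norm k)\<^sup>2 / s\<^sup>2 * (1 - s\<^sup>2))"
    unfolding boost_def s_def [symmetric] h_def [symmetric] t_def [symmetric] k fst_conv snd_conv norm_add_smult_power2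
    using s by (simp add: norm_divide power_divide s2 flip: Re_divide_of_real)
  also have "\<dots> = ((norm (t + h))\<^sup>2 - 2 * s * Re (k * cnj h) - (norm k)\<^sup>2 * (1 - s\<^sup>2)) / s\<^sup>2 - (norm (snd x))\<^sup>2"
    using s by (simp add: field_simps power2_eq_square)
  also have "(norm (t + h))\<^sup>2 - 2 * s * Re (k * cnj h) - (norm k)\<^sup>2 * (1 - s\<^sup>2) = (norm t)\<^sup>2 * s\<^sup>2"
  proof -
    \<comment> \<open>Both sides depend on t and h only through these three real numbers.\<close>
    define X where "X = (norm t)\<^sup>2"
    define Y where "Y = Re (t * cnj h)"
    define Z where "Z = (norm h)\<^sup>2"
    have "(norm (t + h))\<^sup>2 = X + 2 * Y + Z" "Re (k * cnj h) = Y + r * Z" "(norm k)\<^sup>2 = X + 2 * r * Y + r\<^sup>2 * Z"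
      unfolding cmod_power2 k_def X_def Y_def Z_def by (simp_all add: power2_eq_square algebra_simps)
    moreover have "r * (1 - s\<^sup>2) = 1 - s" "r\<^sup>2 * (1 - s\<^sup>2) = 2 * r - 1"
      using r by algebra+
    ultimately show ?thesis
      using r unfolding X_def [symmetric] by algebra
  qed
  finally show ?thesis
    using s by (simp add: t_def)
qed

text \<open>Inside the cone the preserved form is positive, whereas it is at most 0 on vectors whose
  first coordinate vanishes. Hence the quotient defining \<open>ball_aut\<close> has a nonzero
  denominator.\<close>

lemma fst_boost_nonzero:
  assumes "norm (snd x) < norm (fst x)" shows "fst (boost a x) \<noteq> 0"
proof
  assume "fst (boost a x) = 0"
  then have "(norm (fst x))\<^sup>2 - (norm (snd x))\<^sup>2 = - (norm (snd (boost a x)))\<^sup>2"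
    using boost_form [of x] by simp
  moreover have "(norm (snd x))\<^sup>2 < (norm (fst x))\<^sup>2"
    using power_strict_mono [OF assms, of 2] by simp
  ultimately show False
    using zero_le_power2 [of "norm (snd (boost a x))"] by linarith
qed

lemma boost_cone: "norm (snd (boost a x)) < norm (fst (boost a x)) \<longleftrightarrow> norm (snd x) < norm (fst x)"
proof -
  have "norm u < norm v \<longleftrightarrow> 0 < (norm v)\<^sup>2 - (norm u)\<^sup>2" for u :: "complex ^ 'n" and v :: complex
    using power2_less_imp_less [of "norm u" "norm v"] power_strict_mono [of "norm u" "norm v" 2] by auto
  then show ?thesis
    by (simp only: boost_form)
qed

lemma ball_aut_in_ball:
  assumes "z \<in> ball 0 1" shows "ball_aut a z \<in> ball 0 1"
proof -
  have "inverse (norm (fst (boost a (1, z)))) * norm (snd (boost a (1, z))) < 1"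
    using boost_cone [of "(1, z)"] fst_boost_nonzero [of "(1, z)"] assms
    by (simp add: inverse_eq_divide divide_less_eq)
  then show ?thesis
    by (simp add: ball_aut_def norm_inverse)
qed

lemma ball_aut_0: "ball_aut a 0 = a"
  using defect_pos by (simp add: ball_aut_def boost_def vector_smult_assoc)

text \<open>Complex homogeneity is what lets the boost act on the quotients w / t.\<close>

lemma boost_smult: "fst (boost a (c * t, c *s z)) = c * fst (boost a (t, z))"
   "snd (boost a (c * t, c *s z)) = c *s snd (boost a (t, z))"
  by (simp_all add: boost_def hinner_smult_left vec_eq_iff field_simps)

lemma inverse_fst_boost:
  assumes "fst x \<noteq> 0"
  shows "inverse (fst (boost a x)) *s snd (boost a x) = ball_aut a (inverse (fst x) *s snd x)"
  using boost_smult [of "fst x" 1 "inverse (fst x) *s snd x"] assms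
  by (simp add: ball_aut_def vector_smult_assoc)

text \<open>Polarised isometry: \<open>boost a (1, 0)\<close> is (1, a) divided by
  \<open>defect a\<close>, so pairing with (1, a) after the boost is \<open>defect a\<close> times
  pairing with (1, 0) before it. The proof checks this by direct algebra.\<close>

lemma boost_hinner: "fst (boost a x) - hinner (snd (boost a x)) a = of_real (defect a) * fst x"
proof -
  define s where "s = complex_of_real (defect a)"
  have s: "1 + s \<noteq> 0" "s \<noteq> 0"
    using defect_pos by (auto simp: complex_eq_iff s_def)
  have haa: "hinner a a = (1 - s) * (1 + s)"
    using arg_cong [OF defect_power2, of complex_of_real]
    by (simp add: s_def hinner_self algebra_simps power2_eq_square)
  have "(t + h) / s - (h + (t + h / (1 + s)) / s * ((1 - s) * (1 + s))) = s * t" for t h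
    using s by (simp add: divide_simps) algebra
  then show ?thesis
    unfolding boost_def of_real_add of_real_1 s_def [symmetric]
    by (simp add: hinner_add_left hinner_smult_left haa)
qed

text \<open>
  Integrate \<open>F (t, w) = G (w / t)\<close> over the part \<open>\<bar>t - \<langle>w, a\<rangle>\<bar> < 1\<close> of the cone \<open>\<bar>w\<bar> < \<bar>t\<bar>\<close>, directly and after
  applying the boost, which turns the truncation into \<open>defect a * \<bar>t\<bar> < 1\<close>. Carrying out the
  \<open>t\<close>-integral produces the Jacobian of the automorphism on one side and constants on the other.
\<close>

lemma nn_integral_ball_aut:
  fixes G :: "complex ^ 'n \<Rightarrow> ennreal"
  assumes [measurable]: "G \<in> borel_measurable borel"
  shows "(\<integral>\<^sup>+w. indicator (ball 0 1) w * (ennreal ((defect a / norm (1 - hinner w a)) ^ (2 * CARD('n) + 2)) * G w) \<partial>lborel)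
       = (\<integral>\<^sup>+z. indicator (ball 0 1) z * G (ball_aut a z) \<partial>lborel)"
proof -
  define s where "s = defect a"
  have s: "s > 0" using defect_pos by (simp add: s_def)
  let ?n = "2 * CARD('n)"
  \<comment> \<open>The truncation makes the t-integrals finite; after rescaling, both become
    multiples of this one over the unit disc.\<close>
  define J where "J = (\<integral>\<^sup>+t. ennreal (norm t ^ ?n) * indicator (ball 0 1) t \<partial>(lborel :: complex measure))"
  define C where "C = {x :: complex \<times> (complex ^ 'n). norm (snd x) < norm (fst x)}"
  have C: "C \<in> sets borel"
    unfolding C_def by (intro borel_open open_Collect_less continuous_intros)
  have C_iff: "boost a x \<in> C \<longleftrightarrow> x \<in> C" for x
    using boost_cone by (simp add: C_def)
  \<comment> \<open>Both integrands are written in the coordinates (t, w / t), in which t -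
    \<langle>w, a\<rangle> is t times 1 - \<langle>w / t, a\<rangle>.\<close>
  define H1 where "H1 = (\<lambda>x :: complex \<times> (complex ^ 'n). G (snd x) * indicator {x. norm (fst x) * norm (1 - hinner (snd x) a) < 1} x)"
  define H2 where "H2 = (\<lambda>x :: complex \<times> (complex ^ 'n). G (ball_aut a (snd x)) * indicator {x. norm (fst x) * s < 1} x)"
  define F where "F = (\<lambda>x. indicator C x * H1 (fst x, inverse (fst x) *s snd x))"
  have fst: "fst \<in> borel_measurable (borel :: (complex \<times> (complex ^ 'n)) measure)"
    and snd: "snd \<in> borel_measurable (borel :: (complex \<times> (complex ^ 'n)) measure)"
    by (intro borel_measurable_continuous_onI continuous_intros)+
  have H1: "H1 \<in> borel_measurable borel"
    unfolding H1_def
    by (intro borel_measurable_times_ennreal borel_measurable_indicator measurable_compose [OF snd] assms borel_open)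
       (unfold hinner_def, intro open_Collect_less continuous_intros)
  have H2: "H2 \<in> borel_measurable borel"
    unfolding H2_def
    by (intro borel_measurable_times_ennreal borel_measurable_indicator measurable_compose [OF snd]
        measurable_compose [OF ball_aut_measurable] assms borel_open)
       (intro open_Collect_less continuous_intros)
  have F: "F \<in> borel_measurable borel"
    unfolding F_def
    by (intro borel_measurable_times_ennreal borel_measurable_indicator C measurable_compose [OF _ H1]
        borel_measurable_Pair vector_smult_measurable borel_measurable_inverse fst snd)
  have [measurable]: "H1 \<in> borel_measurable (borel \<Otimes>\<^sub>M borel)" "H2 \<in> borel_measurable (borel \<Otimes>\<^sub>M borel)"
    using H1 H2 by (simp_all only: borel_prod)
  have F_boost: "F (boost a x) = indicator C x * H2 (fst x, inverse (fst x) *s snd x)" for x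
  proof (cases "x \<in> C")
    case True
    then have x: "fst x \<noteq> 0" "fst (boost a x) \<noteq> 0"
      using fst_boost_nonzero [of x] by (auto simp: C_def)
    have "fst (boost a x) * (1 - hinner (inverse (fst (boost a x)) *s snd (boost a x)) a)
        = fst (boost a x) - hinner (snd (boost a x)) a"
      using x(2) by (simp add: hinner_smult_left field_simps)
    also have "\<dots> = of_real s * fst x"
      unfolding s_def by (rule boost_hinner)
    finally have *: "norm (fst (boost a x) * (1 - hinner (inverse (fst (boost a x)) *s snd (boost a x)) a)) = norm (of_real s * fst x)"
      by (rule arg_cong)
    have "norm (fst (boost a x)) * norm (1 - hinner (inverse (fst (boost a x)) *s snd (boost a x)) a) = norm (fst x) * s"
      using s * unfolding norm_mult by simp
    then show ?thesis
      using True x by (simp add: F_def H1_def H2_def C_iff inverse_fst_boost indicator_def)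
  qed (simp add: F_def C_iff)
  have "(\<integral>\<^sup>+x. F x \<partial>lborel)
     = (\<integral>\<^sup>+t. \<integral>\<^sup>+z. ennreal (norm t ^ ?n) * (indicator (ball 0 1) z * H1 (t, z)) \<partial>lborel \<partial>lborel)"
    unfolding F_def C_def nn_integral_cone [OF H1] by (intro nn_integral_cong nn_integral_cmult [symmetric]) measurable
  \<comment> \<open>Swapped so that the t-integral comes first: for fixed z in the ball it runs over
    a disc of radius 1 / |1 - \<langle>z, a\<rangle>|.\<close>
  also have "\<dots> = (\<integral>\<^sup>+z. \<integral>\<^sup>+t. ennreal (norm t ^ ?n) * (indicator (ball 0 1) z * H1 (t, z)) \<partial>lborel \<partial>lborel)"
    by (rule lborel_pair.Fubini') (unfold split_beta', measurable)
  also have "\<dots> = (\<integral>\<^sup>+z. indicator (ball 0 1) z * (ennreal (inverse (norm (1 - hinner z a)) ^ (?n + 2)) * G z) * J \<partial>lborel)"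
  proof (rule nn_integral_cong)
    fix z :: "complex ^ 'n"
    show "(\<integral>\<^sup>+t. ennreal (norm t ^ ?n) * (indicator (ball 0 1) z * H1 (t, z)) \<partial>lborel)
      = indicator (ball 0 1) z * (ennreal (inverse (norm (1 - hinner z a)) ^ (?n + 2)) * G z) * J"
    proof (cases "z \<in> ball 0 1")
      case True
      then have pos: "norm (1 - hinner z a) > 0"
        using norm_hinner_less_1 [of z] by auto
      have "(\<integral>\<^sup>+t. ennreal (norm t ^ ?n) * (indicator (ball 0 1) z * H1 (t, z)) \<partial>lborel)
        = (\<integral>\<^sup>+t. G z * (ennreal (norm t ^ ?n) * indicator {t. norm t * norm (1 - hinner z a) < 1} t) \<partial>(lborel :: complex measure))"
        using True by (intro nn_integral_cong) (simp add: H1_def indicator_def mult.commute)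
      also have "\<dots> = G z * (\<integral>\<^sup>+t. ennreal (norm t ^ ?n) * indicator {t. norm t * norm (1 - hinner z a) < 1} t \<partial>(lborel :: complex measure))"
        by (rule nn_integral_cmult) measurable
      also have "\<dots> = G z * (ennreal (inverse (norm (1 - hinner z a)) ^ (?n + 2)) * J)"
        unfolding J_def by (rule arg_cong [OF nn_integral_norm_power_disc [OF pos]])
      finally show ?thesis using True by (simp add: mult_ac)
    qed simp
  qed
  also have "\<dots> = (\<integral>\<^sup>+z. indicator (ball 0 1) z * (ennreal (inverse (norm (1 - hinner z a)) ^ (?n + 2)) * G z) \<partial>lborel) * J"
    by (rule nn_integral_multc) measurable
  finally have 1: "(\<integral>\<^sup>+x. F x \<partial>lborel) = \<dots>" .
  have "(\<integral>\<^sup>+x. F x \<partial>lborel) = (\<integral>\<^sup>+x. F (boost a x) \<partial>lborel)"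
    by (rule nn_integral_boost [OF F, symmetric])
  also have "\<dots> = (\<integral>\<^sup>+t. ennreal (norm t ^ ?n) * (\<integral>\<^sup>+z. indicator (ball 0 1) z * H2 (t, z) \<partial>lborel) \<partial>lborel)"
    unfolding F_boost C_def by (rule nn_integral_cone [OF H2])
  also have "\<dots> = (\<integral>\<^sup>+t. ennreal (norm t ^ ?n) * indicator {t. norm t * s < 1} t * (\<integral>\<^sup>+z. indicator (ball 0 1) z * G (ball_aut a z) \<partial>lborel) \<partial>(lborel :: complex measure))"
    by (intro nn_integral_cong) (simp add: H2_def indicator_def)
  also have "\<dots> = (\<integral>\<^sup>+t. ennreal (norm t ^ ?n) * indicator {t. norm t * s < 1} t \<partial>(lborel :: complex measure)) * (\<integral>\<^sup>+z. indicator (ball 0 1) z * G (ball_aut a z) \<partial>lborel)"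
    by (rule nn_integral_multc) measurable
  also have "\<dots> = ennreal (inverse s ^ (?n + 2)) * J * (\<integral>\<^sup>+z. indicator (ball 0 1) z * G (ball_aut a z) \<partial>lborel)"
    unfolding J_def by (rule arg_cong [OF nn_integral_norm_power_disc [OF s], of "\<lambda>x. x * _"])
  finally have 2: "(\<integral>\<^sup>+z. indicator (ball 0 1) z * (ennreal (inverse (norm (1 - hinner z a)) ^ (?n + 2)) * G z) \<partial>lborel) * J
     = ennreal (inverse s ^ (?n + 2)) * (\<integral>\<^sup>+z. indicator (ball 0 1) z * G (ball_aut a z) \<partial>lborel) * J"
    unfolding 1 by (simp add: mult_ac)
  have "J \<noteq> 0" "J \<noteq> \<infinity>"
    unfolding J_def by (rule nn_integral_norm_power_disc_pos_finite)+
  with 2 have 3: "(\<integral>\<^sup>+z. indicator (ball 0 1) z * (ennreal (inverse (norm (1 - hinner z a)) ^ (?n + 2)) * G z) \<partial>lborel)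
     = ennreal (inverse s ^ (?n + 2)) * (\<integral>\<^sup>+z. indicator (ball 0 1) z * G (ball_aut a z) \<partial>lborel)"
    using ennreal_mult_cancel_left [of J] by (simp only: mult.commute [of _ J] infinity_ennreal_def) simp
  define m where "m = ?n + 2"
  have "(\<integral>\<^sup>+w. indicator (ball 0 1) w * (ennreal ((s / norm (1 - hinner w a)) ^ m) * G w) \<partial>lborel)
     = (\<integral>\<^sup>+w. ennreal (s ^ m) * (indicator (ball 0 1) w * (ennreal (inverse (norm (1 - hinner w a)) ^ m) * G w)) \<partial>lborel)"
  proof (rule nn_integral_cong)
    fix w :: "complex ^ 'n"
    have "ennreal ((s / norm (1 - hinner w a)) ^ m) = ennreal (s ^ m) * ennreal (inverse (norm (1 - hinner w a)) ^ m)"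
      using s by (subst ennreal_mult [symmetric]) (auto simp: divide_inverse power_mult_distrib)
    then show "indicator (ball 0 1) w * (ennreal ((s / norm (1 - hinner w a)) ^ m) * G w)
       = ennreal (s ^ m) * (indicator (ball 0 1) w * (ennreal (inverse (norm (1 - hinner w a)) ^ m) * G w))"
      by (simp only: mult.left_commute mult.assoc)
  qed
  also have "\<dots> = ennreal (s ^ m) * (\<integral>\<^sup>+w. indicator (ball 0 1) w * (ennreal (inverse (norm (1 - hinner w a)) ^ m) * G w) \<partial>lborel)"
    by (rule nn_integral_cmult) measurable
  also have "\<dots> = (ennreal (s ^ m) * ennreal (inverse s ^ m)) * (\<integral>\<^sup>+z. indicator (ball 0 1) z * G (ball_aut a z) \<partial>lborel)"
    unfolding 3 [folded m_def] by (rule mult.assoc [symmetric])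
  also have "ennreal (s ^ m) * ennreal (inverse s ^ m) = 1"
    using s by (subst ennreal_mult [symmetric]) (auto simp: power_inverse)
  finally show ?thesis by (simp only: s_def m_def mult_1_left)
qed

end

section \<open>Mean values of holomorphic functions\<close>

lemma has_derivative_vec_componentwise:
  fixes \<gamma> :: "complex \<Rightarrow> complex ^ 'n"
  assumes "\<And>i. ((\<lambda>t. \<gamma> t $ i) has_field_derivative d $ i) (at t)"
  shows "(\<gamma> has_derivative (\<lambda>c. c *s d)) (at t)"
proof -
  have lin: "bounded_linear (axis i :: complex \<Rightarrow> complex ^ 'n)" for i
    by (intro linear_conv_bounded_linear [THEN iffD1] linearI) (auto simp: vec_eq_iff axis_def)
  have sum_axis: "(\<Sum>i\<in>UNIV. axis i (z $ i)) = z" for z :: "complex ^ 'n"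
    by (simp add: vec_eq_iff axis_def)
  have "((\<lambda>t. \<Sum>i\<in>UNIV. axis i (\<gamma> t $ i)) has_derivative (\<lambda>c. \<Sum>i\<in>UNIV. axis i (d $ i * c))) (at t)"
    using assms by (intro has_derivative_sum bounded_linear.has_derivative [OF lin]) (simp add: has_field_derivative_def)
  moreover have "(\<lambda>c. \<Sum>i\<in>UNIV. axis i (d $ i * c)) = (\<lambda>c. c *s d)"
    using sum_axis [of "_ *s d"] by (simp add: mult.commute)
  ultimately show ?thesis
    by (simp add: sum_axis)
qed

text \<open>Complex linearity of the derivative D turns \<open>D (c *s d)\<close> into c times
  \<open>D d\<close>, so the real derivative of the composite is multiplication by a complex
  number.\<close>

lemma holomorphic_several_on_compose:
  assumes g: "holomorphic_several_on g S" and U: "open U"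
    and "\<And>t. t \<in> U \<Longrightarrow> \<gamma> t \<in> S" and "\<And>i. (\<lambda>t. \<gamma> t $ i) holomorphic_on U"
  shows "(\<lambda>t. g (\<gamma> t)) holomorphic_on U"
proof (subst holomorphic_on_open [OF U], intro ballI)
  fix t assume t: "t \<in> U"
  then obtain D where D: "(g has_derivative D) (at (\<gamma> t))" "\<And>c v. D (c *s v) = c * D v"
    using g assms(3) unfolding holomorphic_several_on_def by blast
  have "\<exists>d. ((\<lambda>t. \<gamma> t $ i) has_field_derivative d) (at t)" for i
    using assms(4) [of i] t holomorphic_on_open [OF U] by blast
  then obtain d where "\<And>i. ((\<lambda>t. \<gamma> t $ i) has_field_derivative d i) (at t)"
    by metis
  then have "(\<gamma> has_derivative (\<lambda>c. c *s (\<chi> i. d i))) (at t)"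
    by (intro has_derivative_vec_componentwise) simp
  from diff_chain_at [OF this D(1)]
  have "((\<lambda>t. g (\<gamma> t)) has_field_derivative D (\<chi> i. d i)) (at t)"
    by (simp add: o_def D(2) has_field_derivative_def mult_commute_abs)
  then show "\<exists>f'. ((\<lambda>t. g (\<gamma> t)) has_field_derivative f') (at t)" ..
qed

lemma holomorphic_several_on_imp_continuous_on:
  "holomorphic_several_on g S \<Longrightarrow> continuous_on S g"
  unfolding holomorphic_several_on_def
  by (meson continuous_at_imp_continuous_on has_derivative_continuous)

lemma circle_mean_value:
  assumes "f holomorphic_on S" "open S" "cball 0 1 \<subseteq> S"
  shows "(LINT x:{0..1}|lborel. f (exp (2 * of_real pi * \<i> * of_real x))) = f 0"
proof -
  have cont: "continuous_on S f"
    using assms(1) by (rule holomorphic_on_imp_continuous_on)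
  have "((\<lambda>u. f u / (u - 0)) has_contour_integral (2 * of_real pi * \<i> * f 0)) (circlepath 0 1)"
    using assms by (intro Cauchy_integral_circlepath continuous_on_subset [OF cont] holomorphic_on_subset [OF assms(1)]) auto
  then have "((\<lambda>x. f (circlepath 0 1 x) / circlepath 0 1 x * vector_derivative (circlepath 0 1) (at x within {0..1}))
      has_integral (2 * of_real pi * \<i> * f 0)) {0..1}"
    by (simp add: has_contour_integral_def)
  \<comment> \<open>On this circle the derivative of the parametrisation is 2 pi i times the point
    itself, which cancels the denominator in Cauchy's formula.\<close>
  then have "((\<lambda>x. (2 * of_real pi * \<i>) * f (exp (2 * of_real pi * \<i> * of_real x))) has_integral (2 * of_real pi * \<i> * f 0)) {0..1}"
    by (rule has_integral_eq [rotated])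
       (subst vector_derivative_circlepath01, auto simp: circlepath field_simps)
  from has_integral_divide [OF this, of "2 * of_real pi * \<i>"]
  have "((\<lambda>x. f (exp (2 * of_real pi * \<i> * of_real x))) has_integral f 0) {0..1}"
    by simp
  moreover have "set_integrable lborel {0..1} (\<lambda>x. f (exp (2 * of_real pi * \<i> * of_real x)))"
    using assms(3)
    by (intro borel_integrable_atLeastAtMost' continuous_on_compose2 [OF cont] continuous_intros)
       (auto simp: norm_exp_eq_Re)
  ultimately show ?thesis
    by (simp add: set_borel_integral_eq_integral integral_unique)
qed

lemma distr_unit_smult:
  assumes "norm c = 1"
  shows "distr lborel borel (\<lambda>z :: complex ^ 'n. c *s z) = lborel"
proof (rule measure_eqI)
  fix A :: "(complex ^ 'n) set"
  assume "A \<in> sets (distr lborel borel ((*s) c))"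
  then have [measurable]: "A \<in> sets borel" by simp
  have "emeasure (distr lborel borel ((*s) c)) A = (\<integral>\<^sup>+z. indicator A z \<partial>distr lborel borel ((*s) c))"
    by simp
  also have "\<dots> = (\<integral>\<^sup>+z. indicator A (c *s z) \<partial>lborel)"
    by (rule nn_integral_distr) auto
  also have "\<dots> = emeasure lborel A"
    by (subst nn_integral_unit_smult [OF _ assms]) auto
  finally show "emeasure (distr lborel borel ((*s) c)) A = emeasure lborel A" .
qed simp

text \<open>Rotation invariance allows averaging over the angle. Integrability of \<open>h\<close>
  justifies Fubini, which moves the average inside, where Cauchy's formula applies on each complex
  line through 0.\<close>

lemma ball_mean_value:
  fixes h :: "complex ^ 'n \<Rightarrow> complex"
  assumes int: "integrable lborel (\<lambda>z. indicator (ball 0 1) z *\<^sub>R h z)"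
    and hol: "\<And>z. z \<in> ball 0 1 \<Longrightarrow> \<exists>S. (\<lambda>t. h (t *s z)) holomorphic_on S \<and> open S \<and> cball 0 1 \<subseteq> S"
  shows "(\<integral>z. indicator (ball 0 1) z *\<^sub>R h z \<partial>lborel) = measure lborel (ball (0 :: complex ^ 'n) 1) *\<^sub>R h 0"
proof -
  define H where "H = (\<lambda>z. indicator (ball 0 1) z *\<^sub>R h z)"
  define e where "e = (\<lambda>x :: real. exp (2 * of_real pi * \<i> * of_real x))"
  define F where "F = (\<lambda>x z. indicator {0..1} x *\<^sub>R H (e x *s z))"
  have [measurable]: "H \<in> borel_measurable borel"
    using int unfolding H_def by (auto dest: borel_measurable_integrable)
  have e: "norm (e x) = 1" for x by (simp add: e_def norm_exp_eq_Re)
  have [measurable]: "e \<in> borel_measurable borel"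
    unfolding e_def by (intro borel_measurable_continuous_onI continuous_intros)
  have rot: "integrable lborel (\<lambda>z. f (e x *s z)) \<longleftrightarrow> integrable lborel f"
    "(\<integral>z. f (e x *s z) \<partial>lborel) = (\<integral>z. f z \<partial>lborel)"
    if "f \<in> borel_measurable borel" for f :: "complex ^ 'n \<Rightarrow> 'b::{banach, second_countable_topology}" and x
    using integrable_distr_eq [of "(*s) (e x)" lborel borel f] integral_distr [of "(*s) (e x)" lborel borel f] that
    by (simp_all add: distr_unit_smult [OF e])
  have int_rot: "integrable lborel (\<lambda>z. H (e x *s z))" for x
    by (subst rot) (use int in \<open>auto simp: H_def\<close>)
  have "integrable (lborel \<Otimes>\<^sub>M lborel) (case_prod F)"
  proof (rule lborel_pair.Fubini_integrable)
    show "case_prod F \<in> borel_measurable (lborel \<Otimes>\<^sub>M lborel)"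
      unfolding F_def split_beta' by measurable
    have "(\<integral>z. norm (case_prod F (x, z)) \<partial>lborel) = indicator {0..1} x *\<^sub>R (\<integral>z. norm (H z) \<partial>lborel)" for x
      using rot(2) [of "\<lambda>z. norm (H z)" x] by (simp add: F_def)
    then show "integrable lborel (\<lambda>x. \<integral>z. norm (case_prod F (x, z)) \<partial>lborel)"
      by simp
    show "AE x in lborel. integrable lborel (\<lambda>z. case_prod F (x, z))"
      using int_rot by (simp add: F_def)
  qed
  then have "(\<integral>z. (\<integral>x. F x z \<partial>lborel) \<partial>lborel) = (\<integral>x. (\<integral>z. F x z \<partial>lborel) \<partial>lborel)"
    by (rule lborel_pair.Fubini_integral)
  also have "(\<lambda>x. \<integral>z. F x z \<partial>lborel) = (\<lambda>x. indicator {0..1} x *\<^sub>R (\<integral>z. H z \<partial>lborel))"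
    using rot(2) [of H] by (simp add: F_def fun_eq_iff)
  also have "(\<lambda>z. \<integral>x. F x z \<partial>lborel) = (\<lambda>z. indicator (ball 0 1) z *\<^sub>R h 0)"
  proof
    fix z :: "complex ^ 'n"
    have "F x z = indicator (ball 0 1) z *\<^sub>R (indicator {0..1} x *\<^sub>R h (e x *s z))" for x
      using e by (simp add: F_def H_def indicator_def)
    then have "(\<integral>x. F x z \<partial>lborel) = indicator (ball 0 1) z *\<^sub>R (LINT x:{0..1}|lborel. h (e x *s z))"
      by (simp add: set_lebesgue_integral_def del: scaleR_scaleR)
    also have "\<dots> = indicator (ball 0 1) z *\<^sub>R h 0"
    proof (cases "z \<in> ball 0 1")
      case True
      then show ?thesis
        using hol [OF True] circle_mean_value [of "\<lambda>t. h (t *s z)"] by (auto simp: e_def)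
    qed simp
    finally show "(\<integral>x. F x z \<partial>lborel) = \<dots>" .
  qed
  also have "(\<integral>z. indicator (ball (0 :: complex ^ 'n) 1) z *\<^sub>R h 0 \<partial>lborel) = measure lborel (ball (0 :: complex ^ 'n) 1) *\<^sub>R h 0"
    using emeasure_bounded_finite [of "ball (0 :: complex ^ 'n) 1"]
    by (subst integral_scaleR_left) (auto simp: integrable_indicator_iff)
  finally show ?thesis by (simp add: H_def)
qed

lemma ball_aut_slice_holomorphic:
  assumes a: "norm a < 1" and g: "holomorphic_several_on g (ball 0 1)" and z: "z \<in> ball 0 1"
  shows "\<exists>S. (\<lambda>t. g (ball_aut a (t *s z))) holomorphic_on S \<and> open S \<and> cball 0 1 \<subseteq> S"
proof (intro exI conjI)
  \<comment> \<open>The disc of radius 1 / norm z, or the whole plane if z = 0. It contains the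
    closed unit disc because norm z < 1.\<close>
  define S where "S = {t :: complex. norm t * norm z < 1}"
  show "open S"
    unfolding S_def by (intro open_Collect_less continuous_intros)
  show "cball 0 1 \<subseteq> S"
    using z by (auto simp: S_def) (meson le_less_trans mult_left_le_one_le norm_ge_zero)
  have S: "t *s z \<in> ball 0 1" if "t \<in> S" for t
    using that by (simp add: S_def)
  have nz: "1 + t * hinner z a \<noteq> 0" if "t \<in> S" for t
    using fst_boost_nonzero [OF a, of "(1, t *s z)"] S [OF that] by (simp add: boost_def hinner_smult_left)
  have sa: "complex_of_real (defect a) \<noteq> 0" "1 + complex_of_real (defect a) \<noteq> 0"
    using defect_pos [OF a] by (auto simp: complex_eq_iff)
  show "(\<lambda>t. g (ball_aut a (t *s z))) holomorphic_on S"
  proof (rule holomorphic_several_on_compose [OF g \<open>open S\<close>])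
    fix t assume "t \<in> S"
    then show "ball_aut a (t *s z) \<in> ball 0 1"
      using S by (intro ball_aut_in_ball a)
  next
    fix i
    show "(\<lambda>t. ball_aut a (t *s z) $ i) holomorphic_on S"
      unfolding ball_aut_def boost_def using nz sa
      by (auto simp: hinner_smult_left intro!: holomorphic_intros)
  qed
qed

text \<open>On indicators, \<open>nn_integral_ball_aut\<close> says that the weighted measure is the
  image of Lebesgue measure on the ball under \<open>ball_aut a\<close>. As an equality of measures
  it carries over to complex integrands, integrability included.\<close>

lemma ball_aut_change_of_variables:
  fixes a :: "complex ^ 'n" and g :: "complex ^ 'n \<Rightarrow> complex"
  assumes a: "norm a < 1" and [measurable]: "g \<in> borel_measurable borel"
  defines "K \<equiv> \<lambda>w. indicator (ball 0 1) w * (defect a / norm (1 - hinner w a)) ^ (2 * CARD('n) + 2)"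
  shows "integrable lborel (\<lambda>w. K w *\<^sub>R g w) \<longleftrightarrow> integrable lborel (\<lambda>z. indicator (ball 0 1) z *\<^sub>R g (ball_aut a z))"
    and "(\<integral>w. K w *\<^sub>R g w \<partial>lborel) = (\<integral>z. indicator (ball 0 1) z *\<^sub>R g (ball_aut a z) \<partial>lborel)"
proof -
  have K: "0 \<le> K w" for w
    using defect_pos [OF a] by (simp add: K_def)
  have [measurable]: "K \<in> borel_measurable borel"
    unfolding K_def by measurable
  have eq: "density lborel (\<lambda>w. ennreal (K w)) = distr (density lborel (\<lambda>z. ennreal (indicator (ball 0 1) z))) borel (ball_aut a)"
    (is "?M = ?N")
  proof (rule measure_eqI)
    fix A assume "A \<in> sets ?M"
    then have [measurable]: "A \<in> sets borel" by simp
    have "emeasure ?M A = (\<integral>\<^sup>+w. indicator (ball 0 1) w * (ennreal ((defect a / norm (1 - hinner w a)) ^ (2 * CARD('n) + 2)) * indicator A w) \<partial>lborel)"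
      by (subst emeasure_density) (auto intro!: nn_integral_cong simp: K_def indicator_def)
    also have "\<dots> = (\<integral>\<^sup>+z. indicator (ball 0 1) z * indicator A (ball_aut a z) \<partial>lborel)"
      by (rule nn_integral_ball_aut [OF a]) simp
    also have "\<dots> = emeasure ?N A"
      by (subst emeasure_distr, simp, simp, subst emeasure_density)
         (simp_all add: measurable_sets_borel [OF ball_aut_measurable], intro nn_integral_cong,
          simp add: indicator_def)
    finally show "emeasure ?M A = emeasure ?N A" .
  qed simp
  have "integrable ?M g \<longleftrightarrow> integrable ?N g" "integral\<^sup>L ?M g = integral\<^sup>L ?N g"
    unfolding eq by simp_all
  then show "integrable lborel (\<lambda>w. K w *\<^sub>R g w) \<longleftrightarrow> integrable lborel (\<lambda>z. indicator (ball 0 1) z *\<^sub>R g (ball_aut a z))"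
    and "(\<integral>w. K w *\<^sub>R g w \<partial>lborel) = (\<integral>z. indicator (ball 0 1) z *\<^sub>R g (ball_aut a z) \<partial>lborel)"
    using K by (simp_all add: integrable_density integral_density integrable_distr_eq integral_distr)
qed

text \<open>On the ball this is the Berezin kernel, the squared modulus of the normalised
  reproducing kernel at \<open>a\<close> of the Bergman space with p = 2.\<close>

definition ball_weight :: "complex ^ 'n \<Rightarrow> complex ^ 'n \<Rightarrow> real" where
  "ball_weight a w = (defect a / norm (1 - hinner w a)) ^ (2 * CARD('n) + 2)"

lemma berezin_mean_value:
  fixes a :: "complex ^ 'n"
  assumes a: "norm a < 1" and g: "holomorphic_several_on g (ball 0 1)"
  assumes int: "set_integrable lborel (ball 0 1) (\<lambda>w. ball_weight a w *\<^sub>R g w)"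
  shows "(LINT w:ball 0 1|lborel. ball_weight a w *\<^sub>R g w) = measure lborel (ball (0 :: complex ^ 'n) 1) *\<^sub>R g a"
proof -
  \<comment> \<open>The values of g off the ball are arbitrary. The cut-off function is Borel on the
    whole space, and nothing is lost because \<open>ball_aut a\<close> maps the ball into
    itself.\<close>
  define G where "G = (\<lambda>w. indicator (ball 0 1) w *\<^sub>R g w)"
  have [measurable]: "G \<in> borel_measurable borel"
    unfolding G_def using holomorphic_several_on_imp_continuous_on [OF g]
    by (intro borel_measurable_continuous_on_indicator) auto
  have K: "indicator (ball 0 1) w *\<^sub>R (ball_weight a w *\<^sub>R g w) = (indicator (ball 0 1) w * ball_weight a w) *\<^sub>R G w" for w
    by (simp add: G_def indicator_def)
  have G: "indicator (ball 0 1) z *\<^sub>R G (ball_aut a z) = indicator (ball 0 1) z *\<^sub>R g (ball_aut a z)" for z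
    using ball_aut_in_ball [OF a, of z] by (simp add: G_def indicator_def)
  have int': "integrable lborel (\<lambda>w. (indicator (ball 0 1) w * ball_weight a w) *\<^sub>R G w)"
    using int unfolding set_integrable_def K .
  have "(LINT w:ball 0 1|lborel. ball_weight a w *\<^sub>R g w) = (\<integral>w. (indicator (ball 0 1) w * ball_weight a w) *\<^sub>R G w \<partial>lborel)"
    unfolding set_lebesgue_integral_def K ..
  also have "\<dots> = (\<integral>z. indicator (ball 0 1) z *\<^sub>R g (ball_aut a z) \<partial>lborel)"
    unfolding ball_weight_def G [symmetric] by (rule ball_aut_change_of_variables(2) [OF a]) simp
  also have "\<dots> = measure lborel (ball (0 :: complex ^ 'n) 1) *\<^sub>R g (ball_aut a 0)"
  proof (rule ball_mean_value)
    show "integrable lborel (\<lambda>z. indicator (ball 0 1) z *\<^sub>R g (ball_aut a z))"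
      unfolding G [symmetric]
      by (rule ball_aut_change_of_variables(1) [OF a, THEN iffD1, OF _ int' [unfolded ball_weight_def]]) simp
  qed (rule ball_aut_slice_holomorphic [OF a g])
  finally show ?thesis by (simp add: ball_aut_0 a)
qed

section \<open>The extremal problem\<close>

lemma measure_unit_ball_pos: "0 < measure lborel (ball (0 :: complex ^ 'n) 1)"
  using emeasure_nu_ball content_ball_pos [of 1 "0 :: complex ^ 'n"] by simp

lemma nu_eq_density:
  "(nu :: (complex ^ 'n) measure) = density lebesgue (\<lambda>_. ennreal (1 / measure lborel (ball (0 :: complex ^ 'n) 1)))"
    (is "_ = density _ (\<lambda>_. ?c)")
proof -
  have "emeasure lebesgue (ball (0 :: complex ^ 'n) 1) = ennreal (measure lborel (ball (0 :: complex ^ 'n) 1))"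
    using emeasure_bounded_finite [of "ball (0 :: complex ^ 'n) 1"]
    by (simp add: emeasure_eq_ennreal_measure)
  then have c: "1 / emeasure lebesgue (ball (0 :: complex ^ 'n) 1) = ?c"
    using measure_unit_ball_pos by (simp add: divide_ennreal flip: ennreal_1)
  show ?thesis
    unfolding nu_def c by (rule measure_eqI) (simp_all add: emeasure_density_const)
qed

text \<open>\<open>nu\<close> lives on the completed sigma-algebra, while the change of variables is
  done for \<open>lborel\<close>. Continuity on the ball makes the integrand Borel, so completion
  changes nothing and only the normalising constant remains.\<close>

lemma set_integral_nu:
  fixes f :: "complex ^ 'n \<Rightarrow> real"
  assumes "continuous_on (ball 0 1) f"
  shows "set_integrable nu (ball 0 1) f \<longleftrightarrow> set_integrable lborel (ball 0 1) f"
    and "(LINT z:ball 0 1|nu. f z) = (LINT z:ball 0 1|lborel. f z) / measure lborel (ball (0 :: complex ^ 'n) 1)"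
proof -
  let ?V = "measure lborel (ball (0 :: complex ^ 'n) 1)"
  have m: "(\<lambda>z. indicator (ball 0 1) z *\<^sub>R f z) \<in> borel_measurable borel"
    using assms by (intro borel_measurable_continuous_on_indicator) auto
  have m': "(\<lambda>z. indicator (ball 0 1) z *\<^sub>R f z) \<in> borel_measurable lebesgue"
    by (rule measurable_completion) (use m in simp)
  show "set_integrable nu (ball 0 1) f \<longleftrightarrow> set_integrable lborel (ball 0 1) f"
    using measure_unit_ball_pos [where 'n = 'n] m m'
    unfolding set_integrable_def nu_eq_density
    by (simp add: integrable_density integrable_completion divide_inverse)
  show "(LINT z:ball 0 1|nu. f z) = (LINT z:ball 0 1|lborel. f z) / ?V"
    using measure_unit_ball_pos [where 'n = 'n] m m'
    unfolding set_lebesgue_integral_def nu_eq_density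
    by (simp add: integral_density integral_completion)
qed

text \<open>The part of S where f is nonzero is open and, by the vanishing integral, null; a
  nonempty open set is not negligible.\<close>

lemma continuous_nonneg_set_integral_eq_0:
  fixes f :: "'a::euclidean_space \<Rightarrow> real"
  assumes "continuous_on S f" "open S" "\<And>x. x \<in> S \<Longrightarrow> 0 \<le> f x"
    and "set_integrable lborel S f" "(LINT x:S|lborel. f x) = 0" and "x \<in> S"
  shows "f x = 0"
proof (rule ccontr)
  assume "f x \<noteq> 0"
  define U where "U = S \<inter> f -` (- {0})"
  have U: "open U" "x \<in> U"
    using assms \<open>f x \<noteq> 0\<close> by (auto simp: U_def intro!: continuous_open_preimage)
  have "AE y in lborel. indicator S y *\<^sub>R f y = 0"
    using assms(3,4,5) unfolding set_integrable_def set_lebesgue_integral_def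
    by (subst (asm) integral_nonneg_eq_0_iff_AE) (auto simp: indicator_def)
  then have "AE y in lborel. y \<notin> U"
    by eventually_elim (auto simp: U_def indicator_def)
  then have "emeasure lborel U = 0"
    using U by (subst (asm) AE_iff_measurable [where N = U]) auto
  then have "negligible U"
    using U by (simp add: negligible_iff_emeasure0 emeasure_completion)
  then show False
    using U open_not_negligible by blast
qed

section \<open>Bernoulli's inequality and tangents of powers, with their equality cases\<close>

lemma powr_ge_tangent_at_1:
  fixes t p :: real
  assumes "1 < p" "0 \<le> t"
  shows "1 + p * (t - 1) \<le> t powr p" and "1 + p * (t - 1) = t powr p \<Longrightarrow> t = 1"
proof -
  have *: "1 + p * (t - 1) \<le> t powr p \<and> (1 + p * (t - 1) = t powr p \<longrightarrow> t = 1)"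
  proof (cases "t = 0")
    case False
    then have t: "t > 0" using assms by simp
    \<comment> \<open>Two bounds are combined: ln x \<le> x - 1 at x = 1 / t, and 1 + y \<le> exp y
      at y = (p - 1) ln t. Equality in the first alone already forces t = 1.\<close>
    have "ln (1 / t) \<le> 1 / t - 1"
      using t by (intro ln_le_minus_one) simp
    then have ln: "t - 1 \<le> t * ln t"
      using t by (simp add: ln_div field_simps)
    have "1 + (p - 1) * ln t \<le> t powr (p - 1)"
      using t exp_ge_add_one_self [of "(p - 1) * ln t"] by (simp add: powr_def)
    then have "t * (1 + (p - 1) * ln t) \<le> t * t powr (p - 1)"
      using t by (intro mult_left_mono) auto
    also have "t * t powr (p - 1) = t powr p"
      using t by (simp add: powr_mult_base)
    finally have le: "t + (p - 1) * (t * ln t) \<le> t powr p"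
      by (simp add: algebra_simps)
    have le': "(p - 1) * (t - 1) \<le> (p - 1) * (t * ln t)"
      using ln assms by (intro mult_left_mono) auto
    have "t = 1" if "1 + p * (t - 1) = t powr p"
    proof -
      have "(p - 1) * (t - 1) = (p - 1) * (t * ln t)"
        using le le' that by (simp add: algebra_simps)
      then have "t - 1 = t * ln t"
        using assms by simp
      then have "ln (1 / t) = 1 / t - 1"
        using t by (simp add: ln_div field_simps)
      then have "1 / t = 1"
        using t by (intro ln_eq_minus_one) auto
      then show ?thesis by simp
    qed
    then show ?thesis
      using le le' by (simp add: algebra_simps)
  qed (use assms in auto)
  then show "1 + p * (t - 1) \<le> t powr p" and "1 + p * (t - 1) = t powr p \<Longrightarrow> t = 1"
    by auto
qed

text \<open>\<open>T\<close> is the tangent at w of the p-th power of the modulus. Scaling by w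
  reduces to w = 1, where Re u \<le> |u| leaves Bernoulli's inequality for |u|. Equality forces |u|
  = Re u = 1, hence u = 1.\<close>

lemma norm_powr_ge_tangent:
  fixes w g :: complex and p :: real
  assumes "1 < p"
  defines "T \<equiv> norm w powr p + p * norm w powr (p - 2) * Re (cnj w * (g - w))"
  shows "T \<le> norm g powr p" and "T = norm g powr p \<Longrightarrow> g = w"
proof -
  have "T \<le> norm g powr p \<and> (T = norm g powr p \<longrightarrow> g = w)"
  proof (cases "w = 0")
    case False
    define u where "u = g / w"
    have g: "g = u * w" using False by (simp add: u_def)
    have "cnj w * (g - w) = of_real ((norm w)\<^sup>2) * (u - 1)"
      by (simp only: g complex_norm_square) (simp add: algebra_simps)
    then have Re_eq: "Re (cnj w * (g - w)) = (norm w)\<^sup>2 * (Re u - 1)"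
      by simp
    have "norm w powr (p - 2) * (norm w)\<^sup>2 = norm w powr p"
      using False by (simp add: powr_diff)
    moreover have "T = norm w powr p + p * (norm w powr (p - 2) * (norm w)\<^sup>2) * (Re u - 1)"
      unfolding T_def Re_eq by (simp only: mult.assoc)
    ultimately have T: "T = norm w powr p * (1 + p * (Re u - 1))"
      by (simp only:) (simp only: distrib_left mult_1_right mult_ac)
    have G: "norm g powr p = norm w powr p * norm u powr p"
      by (simp add: g norm_mult powr_mult)
    have pos: "0 < norm w powr p" using False by simp
    have Re: "1 + p * (Re u - 1) \<le> 1 + p * (norm u - 1)"
      using assms complex_Re_le_cmod [of u] by (simp add: mult_left_mono)
    note bern = powr_ge_tangent_at_1 [OF assms(1), of "norm u"]
    have "g = w" if "T = norm g powr p"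
    proof -
      have "1 + p * (Re u - 1) = norm u powr p"
        using that pos by (simp only: T G mult_cancel_left) simp
      then have "1 + p * (norm u - 1) = norm u powr p" "1 + p * (Re u - 1) = 1 + p * (norm u - 1)"
        using Re bern(1) by auto
      then have "norm u = 1" "Re u = 1"
        using bern(2) assms by auto
      then have "u = 1"
        using cmod_power2 [of u] by (simp add: complex_eq_iff)
      then show ?thesis by (simp add: g)
    qed
    moreover have "T \<le> norm g powr p"
      unfolding T G using Re bern(1) pos by (intro mult_left_mono) auto
    ultimately show ?thesis by blast
  \<comment> \<open>For w = 0 both terms of \<open>T\<close> vanish, and equality then says that the
    p-th power of norm g is 0.\<close>
  qed (use assms in \<open>auto simp: T_def\<close>)
  then show "T \<le> norm g powr p" and "T = norm g powr p \<Longrightarrow> g = w" by auto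
qed

section \<open>Holomorphy and modulus of the extremal function\<close>

lemma holomorphic_several_on_mult:
  assumes "holomorphic_several_on f S" "holomorphic_several_on g S"
  shows "holomorphic_several_on (\<lambda>z. f z * g z) S"
  unfolding holomorphic_several_on_def
proof
  fix z assume "z \<in> S"
  then obtain D E where D: "(f has_derivative D) (at z)" "\<And>c v. D (c *s v) = c * D v"
    and E: "(g has_derivative E) (at z)" "\<And>c v. E (c *s v) = c * E v"
    using assms unfolding holomorphic_several_on_def by metis
  show "\<exists>D. ((\<lambda>z. f z * g z) has_derivative D) (at z) \<and> (\<forall>c v. D (c *s v) = c * D v)"
    using has_derivative_mult [OF D(1) E(1)]
    by (intro exI conjI) (auto simp: D(2) E(2) algebra_simps)
qed

lemma hinner_scaleR_left: "hinner (r *\<^sub>R z) a = r *\<^sub>R hinner z a"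
  by (simp add: hinner_def scaleR_sum_right)

text \<open>Reduces holomorphy of the extremal function, and of the factor that divides it out, to
  one complex variable.\<close>

lemma holomorphic_several_on_hinner:
  fixes a :: "complex ^ 'n"
  assumes a: "norm a < 1" and q: "q holomorphic_on ball 0 1"
  shows "holomorphic_several_on (\<lambda>z. q (hinner z a)) (ball 0 1)"
  unfolding holomorphic_several_on_def
proof
  fix z :: "complex ^ 'n" assume z: "z \<in> ball 0 1"
  have lin: "bounded_linear (\<lambda>z. hinner z a)"
    by (rule bounded_linear_intro [where K = "norm a"])
       (auto simp: hinner_add_left norm_hinner_le hinner_scaleR_left)
  have "hinner z a \<in> ball 0 1"
    using norm_hinner_less_1 [OF a, of z] z by simp
  then obtain d where "(q has_field_derivative d) (at (hinner z a))"
    using q holomorphic_on_open [of "ball 0 1" q] by blast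
  then have "((\<lambda>z. q (hinner z a)) has_derivative (\<lambda>v. d * hinner v a)) (at z)"
    using diff_chain_at [OF bounded_linear_imp_has_derivative [OF lin], of q "(*) d" z]
    by (simp add: o_def has_field_derivative_def)
  then show "\<exists>D. ((\<lambda>z. q (hinner z a)) has_derivative D) (at z) \<and> (\<forall>c v. D (c *s v) = c * D v)"
    by (intro exI conjI) (auto simp: hinner_smult_left)
qed

definition bergman_extremal :: "complex ^ 'n \<Rightarrow> complex \<Rightarrow> real \<Rightarrow> complex ^ 'n \<Rightarrow> complex" where
  "bergman_extremal a w p z = w * (complex_of_real (1 - (norm a)\<^sup>2) / (1 - hinner z a))
      powr complex_of_real (2 * (real CARD('n) + 1) / p)"

context
  fixes a :: "complex ^ 'n" and w :: complex and p :: real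
  assumes p: "1 < p" and a: "norm a < 1"
begin

abbreviation "extremal \<equiv> bergman_extremal a w p"

lemma one_minus_norm_power2_pos: "0 < 1 - (norm a)\<^sup>2"
  using defect_pos [OF a] unfolding defect_power2 [OF a, symmetric] by simp

text \<open>Re (1 / (1 - u)) has the sign of 1 - Re u. This keeps the base off the branch cut of the
  principal power and away from zero.\<close>

lemma Re_base_pos:
  assumes "norm u < 1"
  shows "0 < Re (complex_of_real (1 - (norm a)\<^sup>2) / (1 - u))"
proof -
  have "Re u < 1"
    using assms complex_Re_le_cmod [of u] by linarith
  then show ?thesis
    using one_minus_norm_power2_pos
    by (auto simp: Re_divide power2_eq_square intro!: divide_pos_pos mult_pos_pos add_pos_nonneg)
qed

text \<open>The exponent is arbitrary because both 2(n + 1) / p and its negative occur.\<close>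

lemma base_powr_holomorphic:
  "(\<lambda>u. (complex_of_real (1 - (norm a)\<^sup>2) / (1 - u)) powr c) holomorphic_on ball 0 1"
proof (intro holomorphic_intros)
  fix u :: complex assume u: "u \<in> ball 0 1"
  then show "complex_of_real (1 - (norm a)\<^sup>2) / (1 - u) \<notin> \<real>\<^sub>\<le>\<^sub>0"
    using Re_base_pos [of u] by (auto simp: complex_nonpos_Reals_iff)
  show "1 - u \<noteq> 0" using u by auto
qed

text \<open>The exponent 2(n + 1) / p is real, so the modulus of the power is a power of the
  modulus, and raising to p leaves exponent 2n + 2 as in the Jacobian. Of the two factors
  \<open>defect a\<close> in 1 - |a|^2, one goes into the weight and the other into the
  constant.\<close>

lemma norm_base_powr:
  assumes "z \<in> ball 0 1"
  shows "norm ((complex_of_real (1 - (norm a)\<^sup>2) / (1 - hinner z a)) powr complex_of_real (2 * (real CARD('n) + 1) / p)) powr p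
     = defect a ^ (2 * CARD('n) + 2) * ball_weight a z"
proof -
  have d: "0 < defect a" by (rule defect_pos [OF a])
  have "norm (hinner z a) < 1" using assms norm_hinner_less_1 [OF a] by simp
  then have nz: "0 < norm (1 - hinner z a)" by auto
  define b where "b = norm (complex_of_real (1 - (norm a)\<^sup>2) / (1 - hinner z a))"
  have b: "b = defect a * (defect a / norm (1 - hinner z a))"
    unfolding b_def defect_power2 [OF a, symmetric]
    by (simp add: norm_divide norm_power) (simp add: power2_eq_square)
  then have b0: "0 < b" using d nz by simp
  have "norm ((complex_of_real (1 - (norm a)\<^sup>2) / (1 - hinner z a)) powr complex_of_real (2 * (real CARD('n) + 1) / p)) powr p
     = (b powr (2 * (real CARD('n) + 1) / p)) powr p"
    by (subst norm_powr_real_powr') (auto simp: b_def)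
  also have "\<dots> = b powr real (2 * CARD('n) + 2)"
    using p by (simp add: powr_powr add.commute)
  also have "\<dots> = b ^ (2 * CARD('n) + 2)"
    using b0 by (rule powr_realpow)
  finally show ?thesis
    by (simp only: b ball_weight_def power_mult_distrib)
qed

lemma extremal_holomorphic: "holomorphic_several_on extremal (ball 0 1)"
  unfolding bergman_extremal_def
  by (rule holomorphic_several_on_hinner [OF a holomorphic_on_mult [OF holomorphic_on_const base_powr_holomorphic]])

lemma extremal_at: "extremal a = w"
proof -
  have "1 - (norm a)\<^sup>2 \<noteq> 0" using one_minus_norm_power2_pos by simp
  then have "complex_of_real (1 - (norm a)\<^sup>2) \<noteq> 0" by (simp only: of_real_eq_0_iff simp_thms)
  then show ?thesis by (simp add: bergman_extremal_def hinner_self)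
qed

lemma norm_extremal_powr:
  assumes "z \<in> ball 0 1"
  shows "norm (extremal z) powr p = norm w powr p * (defect a ^ (2 * CARD('n) + 2) * ball_weight a z)"
  unfolding bergman_extremal_def norm_mult powr_mult norm_base_powr [OF assms] ..

lemma continuous_on_ball_weight: "continuous_on (ball 0 1) (ball_weight a)"
proof -
  have "1 - hinner z a \<noteq> 0" if "norm z < 1" for z
    using norm_hinner_less_1 [OF a that] by auto
  then show ?thesis
    unfolding ball_weight_def hinner_def by (intro continuous_intros) (auto simp: hinner_def)
qed

lemma ball_weight_pos:
  assumes "z \<in> ball 0 1" shows "0 < ball_weight a z"
proof -
  have "norm (hinner z a) < 1" using norm_hinner_less_1 [OF a, of z] assms by simp
  then have "0 < norm (1 - hinner z a)" by auto
  then show ?thesis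
    using defect_pos [OF a] unfolding ball_weight_def by (intro zero_less_power divide_pos_pos)
qed

text \<open>Since |a| < 1, the denominator stays away from 0 up to the sphere; this bound yields
  integrability of the weight.\<close>

lemma ball_weight_le:
  assumes "z \<in> ball 0 1" shows "ball_weight a z \<le> (defect a / (1 - norm a)) ^ (2 * CARD('n) + 2)"
proof -
  have "norm (hinner z a) \<le> norm z * norm a" by (rule norm_hinner_le)
  also have "\<dots> \<le> norm a" using assms by (simp add: mult_left_le_one_le)
  finally have "1 - norm a \<le> norm (1 - hinner z a)"
    using norm_triangle_ineq2 [of 1 "hinner z a"] by simp
  then show ?thesis
    using defect_pos [OF a] a unfolding ball_weight_def
    by (intro power_mono divide_left_mono divide_nonneg_pos mult_pos_pos) auto
qed

lemma set_integrable_ball_weight: "set_integrable lborel (ball 0 1) (ball_weight a)"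
  unfolding set_integrable_def
proof (rule Bochner_Integration.integrable_bound)
  let ?C = "(defect a / (1 - norm a)) ^ (2 * CARD('n) + 2)"
  show "integrable lborel (\<lambda>z :: complex ^ 'n. indicator (ball 0 1) z * ?C)"
    using emeasure_bounded_finite [of "ball (0 :: complex ^ 'n) 1"]
    by (intro integrable_mult_left) (auto simp: integrable_indicator_iff)
  show "(\<lambda>z. indicator (ball 0 1) z *\<^sub>R ball_weight a z) \<in> borel_measurable lborel"
    using borel_measurable_continuous_on_indicator [OF _ continuous_on_ball_weight] by simp
  show "AE z in lborel. norm (indicator (ball 0 1) z *\<^sub>R ball_weight a z) \<le> norm (indicator (ball 0 1) z * ?C)"
  proof (rule AE_I2)
    fix z :: "complex ^ 'n"
    show "norm (indicator (ball 0 1) z *\<^sub>R ball_weight a z) \<le> norm (indicator (ball 0 1) z * ?C)"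
      using ball_weight_le [of z] ball_weight_pos [of z] by (auto simp: indicator_def simp del: power_Suc)
  qed
qed

text \<open>The mean value property for the constant function 1: the weight is a probability density
  for normalised Lebesgue measure on the ball.\<close>

lemma integral_ball_weight: "(LINT z:ball 0 1|lborel. ball_weight a z) = measure lborel (ball (0 :: complex ^ 'n) 1)"
proof -
  have "holomorphic_several_on (\<lambda>z :: complex ^ 'n. 1) (ball 0 1)"
    unfolding holomorphic_several_on_def by (intro ballI exI [of _ "\<lambda>_. 0"]) auto
  moreover have int: "set_integrable lborel (ball 0 1) (\<lambda>z. ball_weight a z *\<^sub>R (1 :: complex))"
    using set_integrable_ball_weight
    by (simp add: set_integrable_def scaleR_conv_of_real flip: of_real_mult)
  ultimately have "(LINT z:ball 0 1|lborel. ball_weight a z *\<^sub>R (1 :: complex)) = of_real (measure lborel (ball (0 :: complex ^ 'n) 1))"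
    using berezin_mean_value [OF a, of "\<lambda>_. 1"] by (simp add: scaleR_conv_of_real)
  then show ?thesis
    by (simp add: set_lebesgue_integral_def scaleR_conv_of_real flip: of_real_mult)
qed

lemma extremal_integrable:
  "set_integrable lborel (ball 0 1) (\<lambda>z. norm (extremal z) powr p)"
  and extremal_integral:
  "(LINT z:ball 0 1|lborel. norm (extremal z) powr p)
     = norm w powr p * defect a ^ (2 * CARD('n) + 2) * measure lborel (ball (0 :: complex ^ 'n) 1)"
proof -
  have eq: "indicator (ball 0 1) z *\<^sub>R norm (extremal z) powr p
      = (norm w powr p * defect a ^ (2 * CARD('n) + 2)) * (indicator (ball 0 1) z *\<^sub>R ball_weight a z)" for z
    using norm_extremal_powr [of z] by (auto simp: indicator_def)
  show "set_integrable lborel (ball 0 1) (\<lambda>z. norm (extremal z) powr p)"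
    unfolding set_integrable_def eq
    using set_integrable_ball_weight unfolding set_integrable_def by (rule integrable_mult_right)
  show "(LINT z:ball 0 1|lborel. norm (extremal z) powr p)
     = norm w powr p * defect a ^ (2 * CARD('n) + 2) * measure lborel (ball (0 :: complex ^ 'n) 1)"
    unfolding set_lebesgue_integral_def eq
    using integral_ball_weight unfolding set_lebesgue_integral_def by simp
qed

lemma extremal_minimal:
  assumes f: "holomorphic_several_on f (ball 0 1)" "f a = w"
    and int: "set_integrable lborel (ball 0 1) (\<lambda>z. norm (f z) powr p)"
  shows "(LINT z:ball 0 1|lborel. norm (extremal z) powr p) \<le> (LINT z:ball 0 1|lborel. norm (f z) powr p)"
    and "(LINT z:ball 0 1|lborel. norm (f z) powr p) = (LINT z:ball 0 1|lborel. norm (extremal z) powr p)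
      \<Longrightarrow> z \<in> ball 0 1 \<Longrightarrow> f z = extremal z"
proof -
  define c where "c = complex_of_real (2 * (real CARD('n) + 1) / p)"
  define base where "base = (\<lambda>z. complex_of_real (1 - (norm a)\<^sup>2) / (1 - hinner z a))"
  define g where "g = (\<lambda>z. f z * base z powr (- c))"
  define S where "S = defect a ^ (2 * CARD('n) + 2)"
  let ?B = "ball (0 :: complex ^ 'n) 1"
  let ?V = "measure lborel ?B"
  have S: "0 < S" using defect_pos [OF a] by (simp add: S_def)
  have base: "base z \<noteq> 0" if "z \<in> ?B" for z
    using Re_base_pos [of "hinner z a"] norm_hinner_less_1 [OF a, of z] that by (auto simp: base_def)
  have f_eq: "f z = g z * base z powr c" if "z \<in> ?B" for z
    using base [OF that] by (simp add: g_def powr_minus)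
  have g_hol: "holomorphic_several_on g ?B"
    unfolding g_def base_def
    by (intro holomorphic_several_on_mult f
        holomorphic_several_on_hinner [OF a, of "\<lambda>u. (complex_of_real (1 - (norm a)\<^sup>2) / (1 - u)) powr _"]
        base_powr_holomorphic)
  have ga: "g a = w"
  proof -
    have "1 - (norm a)\<^sup>2 \<noteq> 0" using one_minus_norm_power2_pos by simp
    then have "complex_of_real (1 - (norm a)\<^sup>2) \<noteq> 0" by (simp only: of_real_eq_0_iff simp_thms)
    then show ?thesis by (simp add: g_def base_def hinner_self f)
  qed
  have norm_f: "norm (f z) powr p = S * (ball_weight a z * norm (g z) powr p)" if "z \<in> ?B" for z
    using norm_base_powr [OF that] unfolding f_eq [OF that] norm_mult powr_mult
    by (simp add: base_def c_def S_def)
  have "set_integrable lborel ?B (\<lambda>z. inverse S * (norm (f z) powr p))"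
    using int by simp
  then have int_p: "set_integrable lborel ?B (\<lambda>z. ball_weight a z * norm (g z) powr p)"
    by (rule set_integrable_cong [THEN iffD1, rotated -1]) (use S norm_f in auto)
  have integral_p: "(LINT z:?B|lborel. norm (f z) powr p) = S * (LINT z:?B|lborel. ball_weight a z * norm (g z) powr p)"
    by (subst set_integral_mult_right [symmetric], rule set_lebesgue_integral_cong) (use norm_f in auto)
  have g_cont: "continuous_on ?B g"
    by (rule holomorphic_several_on_imp_continuous_on [OF g_hol])
  \<comment> \<open>The mean value property needs \<open>g\<close> itself to be integrable against
    the weight, while the hypothesis on f controls only its p-th power. The bound |g| \<le> 1 +
    |g|^p bridges the two.\<close>
  have int_1: "set_integrable lborel ?B (\<lambda>z. ball_weight a z *\<^sub>R g z)"
  proof (rule set_integrable_bound)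
    show "set_integrable lborel ?B (\<lambda>z. ball_weight a z + ball_weight a z * norm (g z) powr p)"
      by (intro set_integral_add set_integrable_ball_weight int_p)
    show "set_borel_measurable lborel ?B (\<lambda>z. ball_weight a z *\<^sub>R g z)"
      unfolding set_borel_measurable_def
      using borel_measurable_continuous_on_indicator [of ?B "\<lambda>z. ball_weight a z *\<^sub>R g z"]
      by (auto intro!: continuous_on_scaleR continuous_on_ball_weight g_cont)
    have "norm (ball_weight a z *\<^sub>R g z) \<le> norm (ball_weight a z + ball_weight a z * norm (g z) powr p)" if "z \<in> ?B" for z
    proof -
      have "norm (g z) \<le> 1 + norm (g z) powr p"
      proof (cases "norm (g z) \<le> 1")
        case False
        then have "norm (g z) powr 1 \<le> norm (g z) powr p"
          using p by (intro powr_mono) auto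
        then show ?thesis by simp
      qed (simp add: add_increasing2)
      then have "ball_weight a z * norm (g z) \<le> ball_weight a z * (1 + norm (g z) powr p)"
        using ball_weight_pos [OF that] by (intro mult_left_mono) auto
      then show ?thesis
        using ball_weight_pos [OF that] by (simp add: algebra_simps)
    qed
    then show "AE z in lborel. z \<in> ?B \<longrightarrow> norm (ball_weight a z *\<^sub>R g z) \<le> norm (ball_weight a z + ball_weight a z * norm (g z) powr p)"
      by (intro AE_I2) auto
  qed
  have mean: "(LINT z:?B|lborel. ball_weight a z *\<^sub>R g z) = ?V *\<^sub>R w"
    using berezin_mean_value [OF a g_hol int_1] ga by simp
  \<comment> \<open>The real-linear part of the tangent at w; being bounded, it commutes with the
    integral.\<close>
  define L where "L = (\<lambda>v. p * norm w powr (p - 2) * Re (cnj w * v))"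
  have L: "bounded_linear L"
    unfolding L_def
    using bounded_linear_const_mult [OF bounded_linear_compose [OF bounded_linear_Re bounded_linear_mult_right [of "cnj w"]]] .
  interpret L: bounded_linear L by (rule L)
  \<comment> \<open>The weighted gap between the p-th power of |g| and its tangent at w. It is
    nonnegative on the ball, and its integral measures the excess of f over the extremal
    function.\<close>
  define D where "D = (\<lambda>z. ball_weight a z * (norm (g z) powr p - (norm w powr p + L (g z - w))))"
  have D_alt: "D z = ball_weight a z * norm (g z) powr p - ((norm w powr p - L w) * ball_weight a z + L (ball_weight a z *\<^sub>R g z))" for z
    by (simp add: D_def L.diff L.scaleR algebra_simps)
  have L_ind: "indicator ?B z *\<^sub>R L v = L (indicator ?B z *\<^sub>R v)" for z v
    by (simp only: L.scaleR)
  have L_int: "set_integrable lborel ?B (\<lambda>z. L (ball_weight a z *\<^sub>R g z))"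
    using int_1 unfolding set_integrable_def L_ind by (rule integrable_bounded_linear [OF L])
  have "(LINT z:?B|lborel. L (ball_weight a z *\<^sub>R g z)) = L (LINT z:?B|lborel. ball_weight a z *\<^sub>R g z)"
    using int_1 unfolding set_integrable_def set_lebesgue_integral_def L_ind
    by (rule integral_bounded_linear [OF L])
  then have L_integral: "(LINT z:?B|lborel. L (ball_weight a z *\<^sub>R g z)) = ?V * L w"
    by (simp only: mean L.scaleR real_scaleR_def)
  note W_int = set_integrable_mult_right [OF set_integrable_ball_weight, of "norm w powr p - L w"]
  have D_int: "set_integrable lborel ?B D"
    unfolding D_alt by (intro set_integral_diff set_integral_add int_p W_int L_int)
  have D_eq: "(LINT z:?B|lborel. D z) = (LINT z:?B|lborel. ball_weight a z * norm (g z) powr p) - ((norm w powr p - L w) * ?V + ?V * L w)"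
    unfolding D_alt set_integral_diff(2) [OF int_p set_integral_add(1) [OF W_int L_int]]
      set_integral_add(2) [OF W_int L_int] set_integral_mult_right integral_ball_weight L_integral ..
  \<comment> \<open>The terms in \<open>L w\<close> cancel because g has weighted mean w; what is
    left to subtract is the integral for the extremal function.\<close>
  have D_integral: "S * (LINT z:?B|lborel. D z) = (LINT z:?B|lborel. norm (f z) powr p) - (LINT z:?B|lborel. norm (extremal z) powr p)"
    unfolding extremal_integral integral_p D_eq S_def [symmetric] by algebra
  have tangent: "norm w powr p + L (g z - w) \<le> norm (g z) powr p"
    "norm w powr p + L (g z - w) = norm (g z) powr p \<Longrightarrow> g z = w" for z
    unfolding L_def by (fact norm_powr_ge_tangent [OF p])+
  have D_nonneg: "0 \<le> D z" if "z \<in> ?B" for z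
    using tangent(1) [of z] ball_weight_pos [OF that] by (simp add: D_def)
  have "0 \<le> (LINT z:?B|lborel. D z)"
    unfolding set_lebesgue_integral_def by (intro Bochner_Integration.integral_nonneg) (auto simp: indicator_def D_nonneg)
  then show "(LINT z:?B|lborel. norm (extremal z) powr p) \<le> (LINT z:?B|lborel. norm (f z) powr p)"
    using D_integral mult_nonneg_nonneg [of S "LINT z:?B|lborel. D z"] S by simp
  assume eq: "(LINT z:?B|lborel. norm (f z) powr p) = (LINT z:?B|lborel. norm (extremal z) powr p)" and z: "z \<in> ?B"
  \<comment> \<open>Continuity upgrades vanishing almost everywhere to vanishing at every point of
    the ball.\<close>
  have D_cont: "continuous_on ?B D"
    unfolding D_def
    by (intro continuous_intros continuous_on_ball_weight g_cont L.continuous_on continuous_on_powr') (use p in auto)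
  have "(LINT z:?B|lborel. D z) = 0"
    using D_integral S unfolding eq by simp
  with D_cont open_ball D_nonneg D_int have "D z = 0"
    using z by (rule continuous_nonneg_set_integral_eq_0)
  then have "norm w powr p + L (g z - w) = norm (g z) powr p"
    using ball_weight_pos [OF z] by (simp add: D_def)
  then have "g z = w"
    by (rule tangent(2))
  then show "f z = extremal z"
    using f_eq [OF z] by (simp add: bergman_extremal_def base_def c_def)
qed

end

lemma bergman_norm_eq:
  assumes "holomorphic_several_on f (ball (0 :: complex ^ 'n) 1)" "0 < p"
  shows "set_integrable nu (ball 0 1) (\<lambda>z. norm (f z) powr p) \<longleftrightarrow> set_integrable lborel (ball 0 1) (\<lambda>z. norm (f z) powr p)"
    and "bergman_norm p f = ((LINT z:ball 0 1|lborel. norm (f z) powr p) / measure lborel (ball (0 :: complex ^ 'n) 1)) powr (1 / p)"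
proof -
  have c: "continuous_on (ball 0 1) (\<lambda>z. norm (f z) powr p)"
    using assms holomorphic_several_on_imp_continuous_on [OF assms(1)]
    by (intro continuous_on_powr' continuous_intros) auto
  show "set_integrable nu (ball 0 1) (\<lambda>z. norm (f z) powr p) \<longleftrightarrow> set_integrable lborel (ball 0 1) (\<lambda>z. norm (f z) powr p)"
    by (rule set_integral_nu(1) [OF c])
  show "bergman_norm p f = ((LINT z:ball 0 1|lborel. norm (f z) powr p) / measure lborel (ball (0 :: complex ^ 'n) 1)) powr (1 / p)"
    unfolding bergman_norm_def set_integral_nu(2) [OF c] ..
qed

theorem theorem4p2:
  fixes z0 :: "complex ^ 'n" and w0 :: complex and p :: real
  assumes "1 < p" and "z0 \<in> ball 0 1"
  shows "let f_min = (\<lambda>z. w0 * (complex_of_real (1 - (norm z0)\<^sup>2) / (1 - hinner z z0))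
                              powr complex_of_real (2 * (real CARD('n) + 1) / p));
             admissible = (\<lambda>f. f \<in> bergman_space p \<and> f z0 = w0)
         in is_arg_min (bergman_norm p) admissible f_min
          \<and> (\<forall>f. is_arg_min (bergman_norm p) admissible f \<longrightarrow> (\<forall>z\<in>ball 0 1. f z = f_min z))
          \<and> (\<forall>z\<in>ball 0 1. f_min z =
                w0 * (complex_of_real (1 - (\<Sum>j\<in>UNIV. (norm (z0 $ j))\<^sup>2))
                       / (1 - (\<Sum>j\<in>UNIV. z $ j * cnj (z0 $ j))))
                     powr complex_of_real (2 * (real CARD('n) + 1) / p))
          \<and> bergman_norm p f_min = norm w0 * (1 - (norm z0)\<^sup>2) powr ((real CARD('n) + 1) / p)"
proof -
  have z0: "norm z0 < 1" using assms(2) by simp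
  define F where "F = bergman_extremal z0 w0 p"
  define adm where "adm = (\<lambda>f. f \<in> bergman_space p \<and> f z0 = w0)"
  define J where "J = (\<lambda>f :: complex ^ 'n \<Rightarrow> complex. LINT z:ball 0 1|lborel. norm (f z) powr p)"
  let ?V = "measure lborel (ball (0 :: complex ^ 'n) 1)"
  have V: "0 < ?V" by (rule measure_unit_ball_pos)
  have J_nonneg: "0 \<le> J f" for f
    unfolding J_def set_lebesgue_integral_def by (intro Bochner_Integration.integral_nonneg) (auto simp: indicator_def)
  have F_hol: "holomorphic_several_on F (ball 0 1)"
    unfolding F_def by (rule extremal_holomorphic [OF assms(1) z0])
  have adm_iff: "adm f \<longleftrightarrow> holomorphic_several_on f (ball 0 1) \<and> f z0 = w0 \<and> set_integrable lborel (ball 0 1) (\<lambda>z. norm (f z) powr p)" for f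
    using bergman_norm_eq(1) [of f p] assms(1) by (auto simp: adm_def bergman_space_def)
  have norm_eq: "bergman_norm p f = (J f / ?V) powr (1 / p)" if "adm f" for f
    using bergman_norm_eq(2) [of f p] that assms(1) by (auto simp: adm_iff J_def)
  have F_adm: "adm F"
    unfolding adm_iff using F_hol extremal_at [OF assms(1) z0] extremal_integrable [OF assms(1) z0] by (simp add: F_def)
  have le: "J F \<le> J f" if "adm f" for f
    unfolding J_def F_def using that unfolding adm_iff
    by (intro extremal_minimal(1) [OF assms(1) z0]) auto
  have eq: "f z = F z" if "adm f" "J f = J F" "z \<in> ball 0 1" for f z
    using that unfolding J_def F_def adm_iff
    by (intro extremal_minimal(2) [OF assms(1) z0]) blast+
  have "is_arg_min (bergman_norm p) adm F"
    unfolding is_arg_min_def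
  proof (intro conjI F_adm notI)
    assume "\<exists>f. adm f \<and> bergman_norm p f < bergman_norm p F"
    then obtain f where f: "adm f" "bergman_norm p f < bergman_norm p F" by blast
    have "bergman_norm p F \<le> bergman_norm p f"
      using le [OF f(1)] V assms(1) J_nonneg unfolding norm_eq [OF f(1)] norm_eq [OF F_adm]
      by (intro powr_mono2 divide_right_mono divide_nonneg_nonneg) auto
    with f(2) show False by simp
  qed
  moreover have "f z = F z" if f: "is_arg_min (bergman_norm p) adm f" and z: "z \<in> ball 0 1" for f z
  proof (rule eq)
    show "z \<in> ball 0 1" by (rule z)
    show f_adm: "adm f" using f by (simp add: is_arg_min_def)
    have "\<not> bergman_norm p F < bergman_norm p f"
      using f F_adm unfolding is_arg_min_def by blast
    \<comment> \<open>The p-th root is strictly increasing, so any excess in the integral would show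
      in the norm; a minimiser must attain \<open>J F\<close>.\<close>
    moreover have "bergman_norm p F < bergman_norm p f" if "J F < J f"
      using that V assms(1) J_nonneg unfolding norm_eq [OF f_adm] norm_eq [OF F_adm]
      by (intro powr_less_mono2 divide_strict_right_mono divide_nonneg_nonneg) auto
    ultimately show "J f = J F"
      using le [OF f_adm] by fastforce
  qed
  moreover have "bergman_norm p F = norm w0 * (1 - (norm z0)\<^sup>2) powr ((real CARD('n) + 1) / p)"
  proof -
    \<comment> \<open>Pairing the factors \<open>defect z0\<close> turns the exponent 2n + 2 into
      the n + 1 of the stated norm.\<close>
    have "defect z0 ^ (2 * CARD('n) + 2) = (1 - (norm z0)\<^sup>2) powr (real CARD('n) + 1)"
    proof -
      have "defect z0 ^ (2 * CARD('n) + 2) = ((defect z0)\<^sup>2) ^ (CARD('n) + 1)"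
        by (subst power_mult [symmetric]) simp
      also have "\<dots> = ((defect z0)\<^sup>2) powr real (CARD('n) + 1)"
        using defect_pos [OF z0] by (subst powr_realpow) auto
      finally show ?thesis
        by (simp add: defect_power2 [OF z0] add.commute)
    qed
    then have "J F / ?V = norm w0 powr p * (1 - (norm z0)\<^sup>2) powr (real CARD('n) + 1)"
      using V extremal_integral [OF assms(1) z0, of w0] by (simp add: J_def F_def)
    then show ?thesis
      unfolding norm_eq [OF F_adm] using assms(1)
      by (simp add: powr_mult powr_powr)
  qed
  moreover have "F z = w0 * (complex_of_real (1 - (\<Sum>j\<in>UNIV. (norm (z0 $ j))\<^sup>2))
                       / (1 - (\<Sum>j\<in>UNIV. z $ j * cnj (z0 $ j))))
                     powr complex_of_real (2 * (real CARD('n) + 1) / p)" for z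
    unfolding F_def bergman_extremal_def hinner_def norm_vec_power2 ..
  moreover have F_eq: "F = (\<lambda>z. w0 * (complex_of_real (1 - (norm z0)\<^sup>2) / (1 - hinner z z0))
                              powr complex_of_real (2 * (real CARD('n) + 1) / p))"
    unfolding F_def bergman_extremal_def ..
  ultimately show ?thesis
    unfolding Let_def adm_def F_eq by blast
qed

end
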